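(* Let $G$ be a group and $N$ a normal subgroup of $G$. Then for every rational chain $c \in \mathcal{C}_{\mathbb{Q}}(G,N)$, \[ \mathrm{scl}_{G,N}(c) = \sup_{\mu \in \mathrm{Q}(N)^G \setminus \mathrm{H}^1(N;\mathbb{R})^G} \frac{|\mu(c)|}{2D(\mu)}, \] where the supremum over the empty set is interpreted as $0$.
   Context: Commutators: $[a,b]=aba^{-1}b^{-1}$. A quasimorphism on a group $H$ is $\phi\colon H\to\mathbb{R}$ with finite defect $D(\phi)=\sup_{h_1,h_2\in H}|\phi(h_1h_2)-\phi(h_1)-\phi(h_2)|$; it is homogeneous if $\phi(h^n)=n\phi(h)$ for all $h\in H$, $n\in\mathbb{Z}$. $\mathrm{Q}(N)^G$ denotes the real vector space of homogeneous quasimorphisms $\mu$ on $N$ that are $G$-invariant, i.e. $\mu(gxg^{-1})=\mu(x)$ for all $g\in G$, $x\in N$; $\mathrm{H}^1(N;\mathbb{R})^G$ is the subspace of $G$-invariant homomorphisms $N\to\mathbb{R}$. The mixed commutator subgroup $[G,N]$ is the subgroup generated by all $[g,x]$ with $g\in G$, $x\in N$; $\mathrm{cl}_{G,N}(y)$ for $y\in[G,N]$ is the least number of elements of the form $[g,x]$ ($g\in G,x\in N$) whose product is $y$. Chains: for a commutative unital ring $A$, $\mathrm{C}_1(G;A)$ is the free $A$-module on $G$ and $\mathrm{C}_2(G;A)$ the free $A$-module on $G\times G$; $\partial(g_1,g_2)=g_2-g_1g_2+g_1$, extended linearly. $\mathrm{C}'_2(G,N;A)$ is the submodule generated by pairs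 $(g_1,g_2)$ with $g_1\in N$ or $g_2\in N$; $\mathrm{B}'_1(G,N;A)=\partial\,\mathrm{C}'_2(G,N;A)$; $\mathcal{C}_A(G,N)=\mathrm{C}_1(N;A)\cap \mathrm{B}'_1(G,N;A)$. Mixed cl and scl of chains: for $x_1,\dots,x_m\in N$ with $x_1\cdots x_m\in[G,N]$, $\mathrm{cl}_{G,N}(x_1+\cdots+x_m)=\inf_{g_1,\dots,g_{m-1}\in G}\mathrm{cl}_{G,N}(x_1\,g_1x_2g_1^{-1}\cdots g_{m-1}x_mg_{m-1}^{-1})$ and $\mathrm{scl}_{G,N}(x_1+\cdots+x_m)=\lim_{n\to\infty}\frac1n\mathrm{cl}_{G,N}(x_1^n+\cdots+x_m^n)$ (here $x_1+\cdots+x_m$ denotes the finite list, with repetitions allowed). Every $c\in\mathcal{C}_{\mathbb{Z}}(G,N)$ can be written $c=x_1+\cdots+x_k-\check x_1-\cdots-\check x_l$ with $x_i,\check x_j\in N$ and $x_1\cdots x_k\check x_1^{-1}\cdots\check x_l^{-1}\in[G,N]$, and one sets $\mathrm{scl}_{G,N}(c)=\mathrm{scl}_{G,N}(x_1+\cdots+x_k+\check x_1^{-1}+\cdots+\check x_l^{-1})$. For $c\in\mathcal{C}_{\mathbb{Q}}(G,N)$, choose $m\in\mathbb{N}$ with $mc\in \mathcal{C}_{\mathbb{Z}}(G,N)$ and set $\mathrm{scl}_{G,N}(c)=\frac1m\mathrm{scl}_{G,N}(mc)$. For $\mu\in\mathrm{Q}(N)^G$ and $c=\sum_i t_ix_i$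 ($t_i\in\mathbb{R}$, $x_i\in N$), $\mu(c)=\sum_it_i\mu(x_i)$. *)

theory Defs
  imports "HOL-Algebra.Algebra" Complex_Main "HOL-Library.Extended_Real"
begin

definition gprod :: "('a, 'b) monoid_scheme \<Rightarrow> 'a list \<Rightarrow> 'a" where
  "gprod G xs = foldr (\<lambda>x y. x \<otimes>\<^bsub>G\<^esub> y) xs \<one>\<^bsub>G\<^esub>"

definition gcomm :: "('a, 'b) monoid_scheme \<Rightarrow> 'a \<Rightarrow> 'a \<Rightarrow> 'a" where
  "gcomm G a b = a \<otimes>\<^bsub>G\<^esub> b \<otimes>\<^bsub>G\<^esub> inv\<^bsub>G\<^esub> a \<otimes>\<^bsub>G\<^esub> inv\<^bsub>G\<^esub> b"

definition mixed_comms :: "('a, 'b) monoid_scheme \<Rightarrow> 'a set \<Rightarrow> 'a set" where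
  "mixed_comms G N = {gcomm G g x | g x. g \<in> carrier G \<and> x \<in> N}"

definition mixed_comm_subgroup :: "('a, 'b) monoid_scheme \<Rightarrow> 'a set \<Rightarrow> 'a set" where
  "mixed_comm_subgroup G N = generate G (mixed_comms G N)"

definition mcl :: "('a, 'b) monoid_scheme \<Rightarrow> 'a set \<Rightarrow> 'a \<Rightarrow> nat" where
  "mcl G N y = (LEAST n. \<exists>cs. length cs = n \<and> set cs \<subseteq> mixed_comms G N \<and> gprod G cs = y)"

definition conj_prod :: "('a, 'b) monoid_scheme \<Rightarrow> 'a list \<Rightarrow> 'a list \<Rightarrow> 'a" where
  "conj_prod G gs xs =
     gprod G (map2 (\<lambda>g x. g \<otimes>\<^bsub>G\<^esub> x \<otimes>\<^bsub>G\<^esub> inv\<^bsub>G\<^esub> g) (\<one>\<^bsub>G\<^esub> # gs) xs)"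

definition mcl_list :: "('a, 'b) monoid_scheme \<Rightarrow> 'a set \<Rightarrow> 'a list \<Rightarrow> nat" where
  "mcl_list G N xs = Inf {mcl G N (conj_prod G gs xs) | gs.
      length gs = length xs - 1 \<and> set gs \<subseteq> carrier G}"

definition mscl_list :: "('a, 'b) monoid_scheme \<Rightarrow> 'a set \<Rightarrow> 'a list \<Rightarrow> real" where
  "mscl_list G N xs =
     lim (\<lambda>n::nat. real (mcl_list G N (map (\<lambda>x. x [^]\<^bsub>G\<^esub> n) xs)) / real n)"

text \<open>A 1-chain with coefficients in a ring A is a finitely supported function
  'a => A (the free A-module on G).  B'_1(G,N;A) is the A-span of the boundaries
  \<partial>(g1,g2) = g2 - g1 g2 + g1 with g1 in N or g2 in N.\<close>
definition in_B1' :: "('a, 'b) monoid_scheme \<Rightarrow> 'a set \<Rightarrow> ('a \<Rightarrow> 'r::comm_ring_1) \<Rightarrow> bool" where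
  "in_B1' G N c \<longleftrightarrow> (\<exists>S (a :: 'a \<times> 'a \<Rightarrow> 'r). finite S \<and>
      S \<subseteq> {(g1, g2). g1 \<in> carrier G \<and> g2 \<in> carrier G \<and> (g1 \<in> N \<or> g2 \<in> N)} \<and>
      c = (\<lambda>z. \<Sum>p\<in>S. a p * (of_bool (z = snd p) - of_bool (z = fst p \<otimes>\<^bsub>G\<^esub> snd p)
                                 + of_bool (z = fst p))))"

definition in_CA :: "('a, 'b) monoid_scheme \<Rightarrow> 'a set \<Rightarrow> ('a \<Rightarrow> 'r::comm_ring_1) \<Rightarrow> bool" where
  "in_CA G N c \<longleftrightarrow> finite {z. c z \<noteq> 0} \<and> {z. c z \<noteq> 0} \<subseteq> N \<and> in_B1' G N c"

definition int_chain_rep :: "('a, 'b) monoid_scheme \<Rightarrow> 'a set \<Rightarrow> ('a \<Rightarrow> int) \<Rightarrow> 'a list \<Rightarrow> 'a list \<Rightarrow> bool" where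
  "int_chain_rep G N d xs ys \<longleftrightarrow> set xs \<subseteq> N \<and> set ys \<subseteq> N \<and>
      d = (\<lambda>z. int (count_list xs z) - int (count_list ys z)) \<and>
      gprod G (xs @ map (\<lambda>y. inv\<^bsub>G\<^esub> y) ys) \<in> mixed_comm_subgroup G N"

text \<open>scl of an integral chain (via a chosen representation; well-defined by the paper).\<close>
definition mscl_Z :: "('a, 'b) monoid_scheme \<Rightarrow> 'a set \<Rightarrow> ('a \<Rightarrow> int) \<Rightarrow> real" where
  "mscl_Z G N d = (let (xs, ys) = (SOME (xs, ys). int_chain_rep G N d xs ys)
                   in mscl_list G N (xs @ map (\<lambda>y. inv\<^bsub>G\<^esub> y) ys))"

definition mscl_Q :: "('a, 'b) monoid_scheme \<Rightarrow> 'a set \<Rightarrow> ('a \<Rightarrow> rat) \<Rightarrow> real" where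
  "mscl_Q G N c =
     (let m = (SOME m :: nat. m > 0 \<and> (\<forall>z. of_nat m * c z \<in> \<int>) \<and>
                 in_CA G N (\<lambda>z. \<lfloor>of_nat m * c z\<rfloor>))
      in mscl_Z G N (\<lambda>z. \<lfloor>of_nat m * c z\<rfloor>) / real m)"

definition defect :: "('a, 'b) monoid_scheme \<Rightarrow> 'a set \<Rightarrow> ('a \<Rightarrow> real) \<Rightarrow> real" where
  "defect G N \<mu> = Sup {\<bar>\<mu> (h1 \<otimes>\<^bsub>G\<^esub> h2) - \<mu> h1 - \<mu> h2\<bar> | h1 h2. h1 \<in> N \<and> h2 \<in> N}"

text \<open>Q(N)^G: G-invariant homogeneous quasimorphisms on N (only values on N matter).\<close>
definition inv_hqm :: "('a, 'b) monoid_scheme \<Rightarrow> 'a set \<Rightarrow> ('a \<Rightarrow> real) set" where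
  "inv_hqm G N = {\<mu>. bdd_above {\<bar>\<mu> (h1 \<otimes>\<^bsub>G\<^esub> h2) - \<mu> h1 - \<mu> h2\<bar> | h1 h2. h1 \<in> N \<and> h2 \<in> N}
      \<and> (\<forall>h\<in>N. \<forall>n::int. \<mu> (h [^]\<^bsub>G\<^esub> n) = of_int n * \<mu> h)
      \<and> (\<forall>g\<in>carrier G. \<forall>x\<in>N. \<mu> (g \<otimes>\<^bsub>G\<^esub> x \<otimes>\<^bsub>G\<^esub> inv\<^bsub>G\<^esub> g) = \<mu> x)}"

definition inv_hom :: "('a, 'b) monoid_scheme \<Rightarrow> 'a set \<Rightarrow> ('a \<Rightarrow> real) set" where
  "inv_hom G N = {\<mu>. (\<forall>h1\<in>N. \<forall>h2\<in>N. \<mu> (h1 \<otimes>\<^bsub>G\<^esub> h2) = \<mu> h1 + \<mu> h2)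
      \<and> (\<forall>g\<in>carrier G. \<forall>x\<in>N. \<mu> (g \<otimes>\<^bsub>G\<^esub> x \<otimes>\<^bsub>G\<^esub> inv\<^bsub>G\<^esub> g) = \<mu> x)}"

definition chain_eval :: "('a \<Rightarrow> real) \<Rightarrow> ('a \<Rightarrow> rat) \<Rightarrow> real" where
  "chain_eval \<mu> c = (\<Sum>z\<in>{z. c z \<noteq> 0}. real_of_rat (c z) * \<mu> z)"

definition sup0 :: "real set \<Rightarrow> ereal" where
  "sup0 S = (if S = {} then 0 else Sup (ereal ` S))"

end

(* The lower bound on scl is the usual estimate: mu is at most D(mu) on a mixed commutator, so a product
of k mixed commutators that is also a product of conjugates of x_1^n, ..., x_m^n gives
n |mu(x_1) + ... + mu(x_m)| <= (2 k + m) D(mu).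

For the upper bound, scl is a sublinear functional on rational chains, because replacing entries x, y of
a list by x y costs at most one mixed commutator.  Hahn-Banach gives an additive functional below scl
which agrees with it at c; its values on single group elements form a function mu on N.  As scl vanishes
on x^k - k x and on g x g^-1 - x, mu is homogeneous and G-invariant.  As scl(a + b - ab) <= 1/2,
it has defect at most 1/2.  The last inequality holds because, up to conjugation, (ab)^n and a^n b^n differ by
only (n - 1)/2 commutators when n is odd. *)

theory Submission
  imports Defs "HOL-Library.Function_Algebras"
begin

section \<open>Products of mixed commutators and of conjugates\<close>

text \<open>The length of a list is a minimum over all conjugators and is awkward to manipulate. The
  relation \<open>fills k xs\<close> keeps only an upper bound: some product of conjugates of the
  entries is a product of \<open>k\<close> mixed commutators. Permuting, conjugating or splitting
  entries preserves \<open>k\<close>; merging two entries, or deleting a pair \<open>x\<close>,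
  \<open>inv x\<close>, raises it by one. When the number of such operations is bounded
  independently of the exponent n, their cost vanishes after division by n. This is why scl does not
  depend on the list representing a chain. The passage between (ab)^n and a^n, b^n is different: its
  cost grows with n and leaves the term 1/2. Boundaries involve pairs in G, while lists have entries
  in N; a retraction of G onto N bridges the gap. Chains have rational coefficients and scl is real
  valued, so Hahn-Banach is used with rational scalars and real values. A defect of at most 1/2
  means 2 D(mu) <= 1, so the functional found attains the supremum. If it is a homomorphism, it is
  excluded from the supremum, but then the lower bound with D(mu) = 0 forces scl(c) = 0.\<close>

locale mixed_pair = normal N G for N and G (structure)
begin

abbreviation conj :: "'a \<Rightarrow> 'a \<Rightarrow> 'a" where
  "conj g x \<equiv> g \<otimes> x \<otimes> inv g"

lemma N_carrier [simp]: "x \<in> N \<Longrightarrow> x \<in> carrier G"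
  by (rule mem_carrier)

lemma cancel_left [simp]:
  assumes "x \<in> carrier G" "y \<in> carrier G"
  shows "inv x \<otimes> (x \<otimes> y) = y" "x \<otimes> (inv x \<otimes> y) = y"
  using assms by (simp_all flip: m_assoc)

lemmas group_simps = m_assoc inv_mult_group

section \<open>Mixed commutators and their products\<close>

lemma conj_N [simp]: "g \<in> carrier G \<Longrightarrow> x \<in> N \<Longrightarrow> conj g x \<in> N"
  by (rule inv_op_closed2)

lemma mixed_commsI: "g \<in> carrier G \<Longrightarrow> x \<in> N \<Longrightarrow> gcomm G g x \<in> mixed_comms G N"
  by (auto simp: mixed_comms_def)

lemma mixed_comms_N: "c \<in> mixed_comms G N \<Longrightarrow> c \<in> N"
  by (auto simp: mixed_comms_def gcomm_def)

lemma mixed_comms_conj: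
  assumes "h \<in> carrier G" "c \<in> mixed_comms G N"
  shows "conj h c \<in> mixed_comms G N"
proof -
  obtain g x where gx: "g \<in> carrier G" "x \<in> N" and c: "c = gcomm G g x"
    using assms by (auto simp: mixed_comms_def)
  have "conj h c = gcomm G (conj h g) (conj h x)"
    using assms gx unfolding c gcomm_def by (simp add: group_simps)
  then show ?thesis using assms gx by (simp add: mixed_commsI)
qed

text \<open>The inverse of [g,x] is [x,g], with the element of \<open>N\<close> in the wrong slot;
  by normality it is also the mixed commutator of \<open>inv g\<close> and \<open>conj g x\<close>.
  Thus products of mixed commutators already form a subgroup.\<close>

lemma mixed_comms_inv:
  assumes "c \<in> mixed_comms G N"
  shows "inv c \<in> mixed_comms G N"
proof -
  obtain g x where gx: "g \<in> carrier G" "x \<in> N" and c: "c = gcomm G g x"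
    using assms by (auto simp: mixed_comms_def)
  have "inv c = gcomm G (inv g) (conj g x)"
    using gx unfolding c gcomm_def by (simp add: group_simps)
  then show ?thesis using gx by (simp add: mixed_commsI)
qed

lemma one_mixed_comms: "\<one> \<in> mixed_comms G N"
  using mixed_commsI[of \<one> \<one>] by (simp add: gcomm_def)

text \<open>Exactly \<open>k\<close> factors give a clean recursion on \<open>k\<close>; since
  \<open>\<one>\<close> is a mixed commutator, this amounts to at most \<open>k\<close>
  factors.\<close>

definition mprods :: "nat \<Rightarrow> 'a set" where
  "mprods k = {gprod G cs | cs. length cs = k \<and> set cs \<subseteq> mixed_comms G N}"

lemma mprods_0: "mprods 0 = {\<one>}"
  by (auto simp: mprods_def gprod_def)

lemma mprods_Suc: "mprods (Suc k) = {c \<otimes> u | c u. c \<in> mixed_comms G N \<and> u \<in> mprods k}"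
proof (intro Set.set_eqI iffI)
  fix v assume "v \<in> mprods (Suc k)"
  then obtain cs where "v = gprod G cs" "length cs = Suc k" "set cs \<subseteq> mixed_comms G N"
    by (auto simp: mprods_def)
  then show "v \<in> {c \<otimes> u | c u. c \<in> mixed_comms G N \<and> u \<in> mprods k}"
    by (cases cs) (auto simp: mprods_def gprod_def)
next
  fix v assume "v \<in> {c \<otimes> u | c u. c \<in> mixed_comms G N \<and> u \<in> mprods k}"
  then obtain c cs where *: "v = c \<otimes> gprod G cs" "c \<in> mixed_comms G N"
      "length cs = k" "set cs \<subseteq> mixed_comms G N"
    by (auto simp: mprods_def)
  then have "v = gprod G (c # cs)" by (simp add: gprod_def)
  with * show "v \<in> mprods (Suc k)"
    unfolding mprods_def by (intro CollectI exI[of _ "c # cs"]) auto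
qed

lemma mprods_SucI: "c \<in> mixed_comms G N \<Longrightarrow> u \<in> mprods k \<Longrightarrow> c \<otimes> u \<in> mprods (Suc k)"
  by (auto simp: mprods_Suc)

lemma mprods_N: "u \<in> mprods k \<Longrightarrow> u \<in> N"
  by (induction k arbitrary: u) (auto simp: mprods_0 mprods_Suc mixed_comms_N)

lemma mprods_carrier [simp]: "u \<in> mprods k \<Longrightarrow> u \<in> carrier G"
  using mprods_N by simp

lemma mixed_comms_carrier [simp]: "c \<in> mixed_comms G N \<Longrightarrow> c \<in> carrier G"
  using mixed_comms_N by simp

lemma mprods_1: "c \<in> mixed_comms G N \<Longrightarrow> c \<in> mprods 1"
  using mprods_SucI[of c \<one> 0] by (simp add: mprods_0)

lemma mprods_mult: "u \<in> mprods j \<Longrightarrow> v \<in> mprods k \<Longrightarrow> u \<otimes> v \<in> mprods (j + k)"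
proof (induction j arbitrary: u)
  case (Suc j)
  then obtain c w where "c \<in> mixed_comms G N" "w \<in> mprods j" "u = c \<otimes> w"
    by (auto simp: mprods_Suc)
  then show ?case using Suc mprods_SucI[of c "w \<otimes> v" "j + k"] by (simp add: m_assoc)
qed (auto simp: mprods_0)

lemma mprods_conj:
  assumes "h \<in> carrier G" shows "u \<in> mprods k \<Longrightarrow> conj h u \<in> mprods k"
proof (induction k arbitrary: u)
  case (Suc k)
  then obtain c w where *: "c \<in> mixed_comms G N" "w \<in> mprods k" "u = c \<otimes> w"
    by (auto simp: mprods_Suc)
  then have "conj h u = conj h c \<otimes> conj h w" using assms by (simp add: group_simps)
  then show ?case using * Suc.IH assms by (simp only: mprods_SucI mixed_comms_conj)
qed (use assms in \<open>auto simp: mprods_0\<close>)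

lemma mprods_inv: "u \<in> mprods k \<Longrightarrow> inv u \<in> mprods k"
proof (induction k arbitrary: u)
  case (Suc k)
  then obtain c w where *: "c \<in> mixed_comms G N" "w \<in> mprods k" "u = c \<otimes> w"
    by (auto simp: mprods_Suc)
  then have "inv u = inv w \<otimes> inv c" by (simp add: inv_mult_group)
  then show ?case
    using mprods_mult[OF Suc.IH[OF *(2)] mprods_1[OF mixed_comms_inv[OF *(1)]]] by simp
qed (auto simp: mprods_0)

lemma mprods_mono:
  assumes "u \<in> mprods j" "j \<le> k" shows "u \<in> mprods k"
  using assms(2)
proof (induction k rule: dec_induct)
  case (step n)
  then show ?case using mprods_SucI[OF one_mixed_comms, of u n] by simp
qed (rule assms)

lemma mixed_comm_subgroup_iff: "u \<in> mixed_comm_subgroup G N \<longleftrightarrow> (\<exists>k. u \<in> mprods k)"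
proof
  assume "u \<in> mixed_comm_subgroup G N"
  then show "\<exists>k. u \<in> mprods k" unfolding mixed_comm_subgroup_def
  proof (induction rule: generate.induct)
    case one then show ?case by (auto intro: exI[of _ 0] simp: mprods_0)
  next
    case (incl h) then show ?case using mprods_1 by blast
  next
    case (inv h) then show ?case using mprods_1 mixed_comms_inv by blast
  next
    case (eng h1 h2) then show ?case using mprods_mult by blast
  qed
next
  assume "\<exists>k. u \<in> mprods k"
  then obtain k where "u \<in> mprods k" by blast
  then show "u \<in> mixed_comm_subgroup G N" unfolding mixed_comm_subgroup_def
    by (induction k arbitrary: u)
       (auto simp: mprods_0 mprods_Suc intro: generate.one generate.incl generate.eng)
qed

section \<open>Products of conjugates of the entries of a list\<close>

fun conj_prods :: "'a list \<Rightarrow> 'a set" where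
  "conj_prods [] = {\<one>}"
| "conj_prods (x # xs) = {conj g x \<otimes> w | g w. g \<in> carrier G \<and> w \<in> conj_prods xs}"

lemma conj_prods_ConsI: "g \<in> carrier G \<Longrightarrow> w \<in> conj_prods xs \<Longrightarrow> conj g x \<otimes> w \<in> conj_prods (x # xs)"
  by auto

lemma conj_prods_ConsE:
  assumes "v \<in> conj_prods (x # xs)"
  obtains g w where "g \<in> carrier G" "w \<in> conj_prods xs" "v = conj g x \<otimes> w"
  using assms by auto

declare conj_prods.simps(2) [simp del]

lemma conj_prods_N: "set xs \<subseteq> N \<Longrightarrow> v \<in> conj_prods xs \<Longrightarrow> v \<in> N"
  by (induction xs arbitrary: v) (auto elim!: conj_prods_ConsE)

lemma conj_prods_carrier: "set xs \<subseteq> N \<Longrightarrow> v \<in> conj_prods xs \<Longrightarrow> v \<in> carrier G"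
  using conj_prods_N by simp

lemma conj_prods_conj:
  assumes "h \<in> carrier G"
  shows "set xs \<subseteq> N \<Longrightarrow> v \<in> conj_prods xs \<Longrightarrow> conj h v \<in> conj_prods xs"
proof (induction xs arbitrary: v)
  case (Cons x xs)
  then obtain g w where *: "g \<in> carrier G" "w \<in> conj_prods xs" "v = conj g x \<otimes> w"
    by (auto elim: conj_prods_ConsE)
  then have "conj h v = conj (h \<otimes> g) x \<otimes> conj h w"
    using assms Cons.prems conj_prods_carrier[OF _ *(2)] by (simp add: group_simps)
  also have "\<dots> \<in> conj_prods (x # xs)"
    using * Cons.prems assms by (intro conj_prods_ConsI Cons.IH m_closed) simp_all
  finally show ?case .
qed (use assms in simp)

lemma conj_prods_append:
  assumes "set xs \<subseteq> N" "set ys \<subseteq> N"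
  shows "v \<in> conj_prods xs \<Longrightarrow> w \<in> conj_prods ys \<Longrightarrow> v \<otimes> w \<in> conj_prods (xs @ ys)"
  using assms
proof (induction xs arbitrary: v)
  case (Cons x xs)
  then obtain g u where *: "g \<in> carrier G" "u \<in> conj_prods xs" "v = conj g x \<otimes> u"
    by (auto elim: conj_prods_ConsE)
  have "v \<otimes> w = conj g x \<otimes> (u \<otimes> w)"
    using * Cons.prems conj_prods_carrier[of xs u] conj_prods_carrier[of ys w] by (simp add: m_assoc)
  also have "\<dots> \<in> conj_prods (x # (xs @ ys))"
    using * Cons.prems by (intro conj_prods_ConsI Cons.IH) simp_all
  finally show ?case by simp
qed (use conj_prods_carrier in simp)

text \<open>A factor moved past another absorbs that factor into its own conjugator. Hence only the
  multiset of entries matters, and lists can stand for chains.\<close>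

lemma conj_prods_swap:
  assumes "x \<in> N" "y \<in> N" "set xs \<subseteq> N" "v \<in> conj_prods (x # y # xs)"
  shows "v \<in> conj_prods (y # x # xs)"
proof -
  obtain g h w where *: "g \<in> carrier G" "h \<in> carrier G" "w \<in> conj_prods xs"
    "v = conj g x \<otimes> (conj h y \<otimes> w)" using assms(4) by (elim conj_prods_ConsE) blast
  then have "v = conj h y \<otimes> (conj (inv (conj h y) \<otimes> g) x \<otimes> w)"
    using assms conj_prods_carrier[OF assms(3) *(3)] by (simp add: group_simps)
  also have "\<dots> \<in> conj_prods (y # x # xs)"
    using assms * by (intro conj_prods_ConsI) simp_all
  finally show ?thesis .
qed

lemma conj_prods_move:
  assumes "set (xs @ x # ys) \<subseteq> N" "v \<in> conj_prods (x # xs @ ys)"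
  shows "v \<in> conj_prods (xs @ x # ys)"
  using assms
proof (induction xs arbitrary: v)
  case (Cons y xs)
  then have "v \<in> conj_prods (y # x # xs @ ys)" using conj_prods_swap[of x y "xs @ ys" v] by simp
  then obtain g w where *: "g \<in> carrier G" "w \<in> conj_prods (x # xs @ ys)" "v = conj g y \<otimes> w"
    by (rule conj_prods_ConsE)
  then have "v \<in> conj_prods (y # (xs @ x # ys))"
    using Cons.prems unfolding *(3) by (intro conj_prods_ConsI Cons.IH) simp_all
  then show ?case by simp
qed simp

lemma conj_prods_perm:
  assumes "mset xs = mset ys" "set xs \<subseteq> N"
  shows "v \<in> conj_prods xs \<Longrightarrow> v \<in> conj_prods ys"
  using assms
proof (induction xs arbitrary: ys v)
  case (Cons x xs)
  then obtain as bs where ys: "ys = as @ x # bs"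
    by (metis list.set_intros(1) set_mset_mset split_list)
  have m: "mset xs = mset (as @ bs)" using Cons.prems(2) ys by simp
  obtain g w where *: "g \<in> carrier G" "w \<in> conj_prods xs" "v = conj g x \<otimes> w"
    using Cons.prems(1) by (rule conj_prods_ConsE)
  have "w \<in> conj_prods (as @ bs)" using Cons.IH[OF *(2) m] Cons.prems by simp
  then have "v \<in> conj_prods (x # as @ bs)" using * by (simp add: conj_prods_ConsI)
  moreover have "set ys = set (x # xs)" using Cons.prems(2) by (metis set_mset_mset)
  ultimately show ?case using Cons.prems(3) unfolding ys by (intro conj_prods_move) simp_all
qed simp

text \<open>Inversion reverses the order of the factors; conjugating the first one by the inverse of
  the remaining product \<open>w\<close> restores it.\<close>

lemma conj_prods_inv:
  "set xs \<subseteq> N \<Longrightarrow> v \<in> conj_prods xs \<Longrightarrow> inv v \<in> conj_prods (map (\<lambda>x. inv x) xs)"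
proof (induction xs arbitrary: v)
  case (Cons x xs)
  then obtain g w where *: "g \<in> carrier G" "w \<in> conj_prods xs" "v = conj g x \<otimes> w"
    by (auto elim: conj_prods_ConsE)
  have w: "w \<in> carrier G" and x: "x \<in> N" using conj_prods_carrier * Cons.prems by auto
  have "inv v = conj (inv w \<otimes> g) (inv x) \<otimes> inv w"
    using * w x by (simp add: group_simps)
  also have "\<dots> \<in> conj_prods (map (\<lambda>x. inv x) (x # xs))"
    using * w x Cons by (simp add: conj_prods_ConsI)
  finally show ?case .
qed auto

lemma gprod_carrier: "set xs \<subseteq> N \<Longrightarrow> gprod G xs \<in> carrier G"
  by (induction xs) (auto simp: gprod_def)

text \<open>Each conjugator costs one commutator, as
  \<open>conj g x = gcomm G g x \<otimes> x\<close>. Membership in [G,N] can therefore be tested on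
  the plain product.\<close>

lemma conj_prods_gprod:
  "set xs \<subseteq> N \<Longrightarrow> v \<in> conj_prods xs \<Longrightarrow> \<exists>u \<in> mprods (length xs). v = u \<otimes> gprod G xs"
proof (induction xs arbitrary: v)
  case Nil then show ?case by (simp add: mprods_0 gprod_def)
next
  case (Cons x xs)
  then obtain g w where *: "g \<in> carrier G" "w \<in> conj_prods xs" "v = conj g x \<otimes> w"
    by (auto elim: conj_prods_ConsE)
  with Cons obtain u where u: "u \<in> mprods (length xs)" "w = u \<otimes> gprod G xs" by auto
  have x: "x \<in> N" using Cons.prems by simp
  have "v = gcomm G g x \<otimes> conj x u \<otimes> gprod G (x # xs)"
    using * u x gprod_carrier[of xs] Cons.prems by (simp add: group_simps gcomm_def gprod_def)
  moreover have "gcomm G g x \<otimes> conj x u \<in> mprods (length (x # xs))"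
    using * u x by (auto intro!: mprods_SucI mixed_commsI mprods_conj)
  ultimately show ?case by blast
qed

lemma gprod_conj_prods: "set xs \<subseteq> N \<Longrightarrow> gprod G xs \<in> conj_prods xs"
proof (induction xs)
  case (Cons x xs)
  then show ?case using conj_prods_ConsI[of \<one> "gprod G xs" xs x] by (simp add: gprod_def)
qed (simp add: gprod_def)

section \<open>Calculus of upper bounds for the mixed commutator length of a list\<close>

definition fills :: "nat \<Rightarrow> 'a list \<Rightarrow> bool" where
  "fills k xs \<longleftrightarrow> set xs \<subseteq> N \<and> conj_prods xs \<inter> mprods k \<noteq> {}"

lemma fillsI: "set xs \<subseteq> N \<Longrightarrow> v \<in> conj_prods xs \<Longrightarrow> v \<in> mprods k \<Longrightarrow> fills k xs"
  by (auto simp: fills_def)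

lemma fillsE:
  assumes "fills k xs"
  obtains v where "set xs \<subseteq> N" "v \<in> conj_prods xs" "v \<in> mprods k"
  using assms by (auto simp: fills_def)

lemma fills_N: "fills k xs \<Longrightarrow> set xs \<subseteq> N"
  by (simp add: fills_def)

lemma fills_Nil: "fills 0 []"
  by (simp add: fills_def mprods_0)

lemma fills_mono: "fills j xs \<Longrightarrow> j \<le> k \<Longrightarrow> fills k xs"
  using mprods_mono by (auto simp: fills_def)

lemma fills_perm:
  assumes "fills k xs" "mset xs = mset ys" shows "fills k ys"
proof -
  have "set ys = set xs" using assms(2) by (metis set_mset_mset)
  then show ?thesis using assms conj_prods_perm[OF assms(2)] by (auto simp: fills_def)
qed

lemma fills_append: "fills j xs \<Longrightarrow> fills k ys \<Longrightarrow> fills (j + k) (xs @ ys)"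
  by (elim fillsE, rule fillsI[OF _ conj_prods_append mprods_mult]) auto

lemma fills_inv: "fills k xs \<Longrightarrow> fills k (map (\<lambda>x. inv x) xs)"
  by (elim fillsE, rule fillsI[OF _ conj_prods_inv mprods_inv]) auto

lemma fills_split:
  assumes "fills k (x \<otimes> y # xs)" "x \<in> N" "y \<in> N" shows "fills k (x # y # xs)"
proof -
  obtain v where v: "set xs \<subseteq> N" "v \<in> conj_prods (x \<otimes> y # xs)" "v \<in> mprods k"
    using assms(1) by (auto elim: fillsE)
  then obtain g w where gw: "g \<in> carrier G" "w \<in> conj_prods xs" "v = conj g (x \<otimes> y) \<otimes> w"
    by (auto elim: conj_prods_ConsE)
  then have "v = conj g x \<otimes> (conj g y \<otimes> w)"
    using assms conj_prods_carrier v by (simp add: group_simps)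
  also have "\<dots> \<in> conj_prods (x # y # xs)" using gw by (intro conj_prods_ConsI)
  finally show ?thesis using v assms by (intro fillsI[of _ v]) auto
qed

text \<open>The conjugators \<open>g\<close> and \<open>h\<close> of the two entries need not agree,
  and one commutator with \<open>inv g \<otimes> h\<close> aligns them. Splitting, by contrast,
  keeps the same group element and is free.\<close>

lemma fills_merge:
  assumes "fills k (x # y # xs)" shows "fills (Suc k) (x \<otimes> y # xs)"
proof -
  obtain v where v: "x \<in> N" "y \<in> N" "set xs \<subseteq> N" "v \<in> conj_prods (x # y # xs)" "v \<in> mprods k"
    using assms by (auto elim: fillsE)
  then obtain g h w where gw: "g \<in> carrier G" "h \<in> carrier G" "w \<in> conj_prods xs"
    "v = conj g x \<otimes> (conj h y \<otimes> w)" by (elim conj_prods_ConsE) blast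
  define c where "c = conj (g \<otimes> x) (gcomm G (inv g \<otimes> h) y)"
  have c: "c \<in> mixed_comms G N"
    using v gw unfolding c_def by (intro mixed_comms_conj mixed_commsI) auto
  have "conj g (x \<otimes> y) \<otimes> w = inv c \<otimes> v"
    using v gw conj_prods_carrier[OF v(3) gw(3)] unfolding c_def gcomm_def
    by (simp add: group_simps)
  also have "\<dots> \<in> mprods (Suc k)" using c v by (intro mprods_SucI mixed_comms_inv)
  finally show ?thesis using v gw by (intro fillsI[OF _ conj_prods_ConsI]) simp_all
qed

lemma fills_one: "fills k xs \<Longrightarrow> fills k (\<one> # xs)"
proof (elim fillsE)
  fix v assume *: "set xs \<subseteq> N" "v \<in> conj_prods xs" "v \<in> mprods k"
  then have "v \<in> conj_prods (\<one> # xs)" using conj_prods_ConsI[of \<one> v xs \<one>] by simp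
  then show ?thesis using * by (intro fillsI) auto
qed

lemma fills_drop_one: assumes "fills k (\<one> # xs)" shows "fills k xs"
proof -
  obtain v where v: "set xs \<subseteq> N" "v \<in> conj_prods (\<one> # xs)" "v \<in> mprods k"
    using assms by (auto elim: fillsE)
  then have "v \<in> conj_prods xs"
    using conj_prods_carrier[OF v(1)] by (elim conj_prods_ConsE) simp
  with v show ?thesis by (intro fillsI)
qed

lemma fills_cancel: "fills k xs \<Longrightarrow> x \<in> N \<Longrightarrow> fills k (x # inv x # xs)"
  using fills_split[of k x "inv x" xs] fills_one[of k xs] by simp

text \<open>Unlike insertion, where both entries can be given the same conjugator, deletion meets
  conjugators that may differ, hence the extra commutator.\<close>

lemma fills_drop_cancel:
  assumes "fills k (x # inv x # xs)" shows "fills (Suc k) xs"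
proof -
  have "x \<in> N" using fills_N[OF assms] by simp
  then show ?thesis using fills_merge[OF assms] fills_drop_one[of "Suc k" xs] by simp
qed

lemma fills_conj:
  assumes "fills k (x # xs)" "g \<in> carrier G" shows "fills k (conj g x # xs)"
proof -
  obtain v where v: "x \<in> N" "set xs \<subseteq> N" "v \<in> conj_prods (x # xs)" "v \<in> mprods k"
    using assms by (auto elim: fillsE)
  then obtain h w where hw: "h \<in> carrier G" "w \<in> conj_prods xs" "v = conj h x \<otimes> w"
    by (auto elim: conj_prods_ConsE)
  then have "v = conj (h \<otimes> inv g) (conj g x) \<otimes> w"
    using assms v conj_prods_carrier by (simp add: group_simps)
  also have "\<dots> \<in> conj_prods (conj g x # xs)" using hw assms by (intro conj_prods_ConsI) auto
  finally show ?thesis using v assms by (intro fillsI) auto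
qed

lemma fills_gprod_iff:
  assumes "set xs \<subseteq> N"
  shows "(\<exists>k. fills k xs) \<longleftrightarrow> gprod G xs \<in> mixed_comm_subgroup G N"
proof
  assume "\<exists>k. fills k xs"
  then obtain k v where v: "v \<in> conj_prods xs" "v \<in> mprods k" by (auto elim: fillsE)
  then obtain u where u: "u \<in> mprods (length xs)" "v = u \<otimes> gprod G xs"
    using conj_prods_gprod assms by blast
  then have "gprod G xs = inv u \<otimes> v" using gprod_carrier[OF assms] by simp
  also have "\<dots> \<in> mprods (length xs + k)" using u v by (intro mprods_mult mprods_inv)
  finally show "gprod G xs \<in> mixed_comm_subgroup G N" unfolding mixed_comm_subgroup_iff by blast
next
  assume "gprod G xs \<in> mixed_comm_subgroup G N"
  then show "\<exists>k. fills k xs"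
    unfolding mixed_comm_subgroup_iff using gprod_conj_prods[OF assms] assms by (blast intro: fillsI)
qed

text \<open>Cut \<open>a\<^sup>i b\<^sup>j (ab)\<^sup>2\<^sup>k\<^sup>+\<^sup>2\<close> into
  \<open>U = a\<^sup>i b\<^sup>j a\<close> and \<open>V = b (ab)\<^sup>2\<^sup>k\<^sup>+\<^sup>1\<close>; conjugating \<open>U\<close> by \<open>a\<close> and \<open>V\<close> by \<open>b\<close>
  lengthens both runs by two at the cost of a single commutator.  This halving is what makes
  the constant \<open>1/2\<close> appear in the duality.\<close>

lemma power_product_normal_form:
  assumes a: "a \<in> N" and b: "b \<in> N"
  shows "\<exists>h \<in> carrier G. \<exists>u \<in> mprods k.
    a [^] i \<otimes> b [^] j \<otimes> (a \<otimes> b) [^] (2 * k) = conj h (u \<otimes> (a [^] (i + 2 * k) \<otimes> b [^] (j + 2 * k)))"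
proof (induction k arbitrary: i j)
  case 0
  show ?case using a b by (intro bexI[of _ \<one>]) (auto simp: mprods_0)
next
  case (Suc k)
  define p where "p = (a \<otimes> b) [^] (2 * k)"
  define A where "A = a [^] i"
  define B where "B = b [^] j"
  have p: "p \<in> carrier G" and A: "A \<in> carrier G" and B: "B \<in> carrier G"
    and ac: "a \<in> carrier G" and bc: "b \<in> carrier G"
    using a b by (auto simp: p_def A_def B_def)
  have pc: "p \<otimes> (a \<otimes> b) = a \<otimes> b \<otimes> p"
    unfolding p_def using a b by (metis nat_pow_Suc nat_pow_Suc2 m_closed N_carrier)
  define U where "U = A \<otimes> B \<otimes> a"
  define V where "V = b \<otimes> p \<otimes> a \<otimes> b"
  have pN: "p \<in> N" unfolding p_def using a b
    by (induction k) (auto simp: nat_pow_Suc)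
  have V: "V \<in> N" unfolding V_def using a b pN by auto
  have Uc: "U \<in> carrier G" unfolding U_def using A B ac by simp
  \<comment> \<open>\<open>inv a \<otimes> b\<close> is the quotient of the intended conjugators
    \<open>a\<close> of \<open>U\<close> and \<open>b\<close> of \<open>V\<close>; once
    \<open>c\<close> is split off, both differ from the intended ones by the common factor
    \<open>inv a\<close>.\<close>
  define c where "c = conj U (gcomm G (inv a \<otimes> b) V)"
  have c: "c \<in> mixed_comms G N"
    unfolding c_def using Uc V a b by (intro mixed_comms_conj mixed_commsI) auto
  define W where "W = a [^] (i + 2) \<otimes> b [^] (j + 2) \<otimes> (a \<otimes> b) [^] (2 * k)"
  obtain h u where hu: "h \<in> carrier G" "u \<in> mprods k"
    and W: "W = conj h (u \<otimes> (a [^] (i + 2 + 2 * k) \<otimes> b [^] (j + 2 + 2 * k)))"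
    using Suc.IH[of "i + 2" "j + 2"] unfolding W_def by blast
  define Z where "Z = a [^] (i + 2 + 2 * k) \<otimes> b [^] (j + 2 + 2 * k)"
  have Z: "Z \<in> carrier G" unfolding Z_def using a b by simp
  have W2: "W = a \<otimes> (a \<otimes> (A \<otimes> (B \<otimes> (b \<otimes> (b \<otimes> p)))))"
  proof -
    have "a [^] (i + 2) = a \<otimes> (a \<otimes> A)"
      unfolding A_def using ac by (metis add_2_eq_Suc' nat_pow_Suc2)
    moreover have "b [^] (j + 2) = B \<otimes> (b \<otimes> b)"
      unfolding B_def using bc by (simp add: m_assoc numeral_2_eq_2)
    ultimately show ?thesis unfolding W_def p_def[symmetric] using A B ac bc p by (simp add: m_assoc)
  qed
  have "a [^] i \<otimes> b [^] j \<otimes> (a \<otimes> b) [^] (2 * Suc k) = A \<otimes> B \<otimes> (p \<otimes> (a \<otimes> b) \<otimes> (a \<otimes> b))"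
    using ac bc unfolding A_def B_def p_def by (simp add: m_assoc)
  also have "\<dots> = A \<otimes> B \<otimes> (a \<otimes> b \<otimes> p \<otimes> (a \<otimes> b))" unfolding pc ..
  also have "\<dots> = U \<otimes> V" unfolding U_def V_def using A B ac bc p by (simp add: m_assoc)
  also have "\<dots> = inv c \<otimes> (U \<otimes> conj (inv a \<otimes> b) V)"
    unfolding c_def gcomm_def using Uc V ac bc by (simp add: group_simps)
  \<comment> \<open>\<open>conj a U \<otimes> conj b V\<close> equals
    \<open>inv a \<otimes> W \<otimes> a\<close>: a further conjugation by \<open>a\<close> moves
    the trailing \<open>a\<close> to the front and completes the run in \<open>W\<close>.\<close>
  also have "\<dots> = inv c \<otimes> (inv a \<otimes> (inv a \<otimes> W \<otimes> a) \<otimes> a)"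
    unfolding W2 U_def V_def using A B ac bc p c by (simp add: group_simps)
  also have "\<dots> = conj (inv a \<otimes> (inv a \<otimes> h))
      (conj (inv (inv a \<otimes> (inv a \<otimes> h))) (inv c) \<otimes> u \<otimes> Z)"
    unfolding W Z_def[symmetric] using c hu ac Z by (simp add: group_simps)
  finally have "a [^] i \<otimes> b [^] j \<otimes> (a \<otimes> b) [^] (2 * Suc k) = \<dots>" .
  moreover have "conj (inv (inv a \<otimes> (inv a \<otimes> h))) (inv c) \<otimes> u \<in> mprods (Suc k)"
    using c hu ac by (intro mprods_SucI mixed_comms_conj mixed_comms_inv) auto
  moreover have "conj h' (v \<otimes> Z) = conj h' (v \<otimes> (a [^] (i + 2 * Suc k) \<otimes> b [^] (j + 2 * Suc k)))" for h' v
    by (simp add: Z_def)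
  moreover have "inv a \<otimes> (inv a \<otimes> h) \<in> carrier G" using ac hu by simp
  ultimately show ?case by metis
qed

text \<open>One factor \<open>a \<otimes> b\<close> of the odd power supplies the initial runs
  \<open>i = j = 1\<close>; the remaining \<open>2 * k\<close> factors are absorbed in pairs, at one
  commutator per pair.\<close>

lemma fills_odd_power:
  assumes a: "a \<in> N" and b: "b \<in> N" and n_def: "n = 2 * k + 1"
  shows "fills k [inv ((a \<otimes> b) [^] n), a [^] n, b [^] n]"
proof -
  have ab: "a \<otimes> b \<in> N" using a b by simp
  have pw: "x [^] m \<in> N" if "x \<in> N" for x and m :: nat using that by (induction m) auto
  define q A B where "q = (a \<otimes> b) [^] n" and "A = a [^] n" and "B = b [^] n"
  have q: "q \<in> N" "A \<in> N" "B \<in> N" unfolding q_def A_def B_def using pw a b ab by auto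
  have "q = a [^] (1::nat) \<otimes> b [^] (1::nat) \<otimes> (a \<otimes> b) [^] (2 * k)"
    unfolding q_def n_def using a b by (metis N_carrier Suc_eq_plus1 ab nat_pow_Suc2 nat_pow_eone)
  then obtain h u where hu: "h \<in> carrier G" "u \<in> mprods k" "q = conj h (u \<otimes> (A \<otimes> B))"
    using power_product_normal_form[OF a b, of k 1 1] unfolding A_def B_def n_def
    by (auto simp: add.commute)
  \<comment> \<open>Conjugation by \<open>inv h\<close> strips the outer conjugator from
    \<open>inv q\<close> and leaves \<open>inv (A \<otimes> B) \<otimes> inv u\<close>; multiplied
    by \<open>A \<otimes> B\<close> this is a conjugate of \<open>inv u\<close>.\<close>
  have "conj (inv h) (inv q) \<otimes> (conj \<one> A \<otimes> (conj \<one> B \<otimes> \<one>)) \<in> conj_prods [inv q, A, B]"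
    using hu by (intro conj_prods_ConsI) auto
  moreover have "conj (inv h) (inv q) \<otimes> (conj \<one> A \<otimes> (conj \<one> B \<otimes> \<one>)) = conj (inv (A \<otimes> B)) (inv u)"
    unfolding hu(3) using hu q by (simp add: group_simps)
  moreover have "\<dots> \<in> mprods k" using hu q by (intro mprods_conj mprods_inv) auto
  ultimately show ?thesis using q unfolding q_def A_def B_def by (intro fillsI) auto
qed

end

section \<open>Fekete's lemma and the Hahn-Banach theorem over the rationals\<close>

text \<open>Fekete's argument: dividing n by a fixed k with remainder bounds u n by (n / k) u k plus
  the constant \<open>M\<close>, which covers all remainders. The limit is the infimum of the
  quotients.\<close>

lemma subadditive_convergent:
  fixes u :: "nat \<Rightarrow> real"
  assumes nonneg: "\<And>n. 0 \<le> u n" and subadd: "\<And>m n. u (m + n) \<le> u m + u n"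
  shows "convergent (\<lambda>n. u n / real n)"
proof -
  define L where "L = (INF n\<in>{1..}. u n / real n)"
  have bdd: "bdd_below ((\<lambda>n. u n / real n) ` {1..})"
    using nonneg by (intro bdd_belowI[of _ 0]) auto
  have lower: "L \<le> u n / real n" if "n \<ge> 1" for n
    unfolding L_def using that bdd by (intro cINF_lower) auto
  have mult: "u (q * k + r) \<le> real q * u k + u r" for q k r
  proof (induction q)
    case (Suc q)
    then show ?case using subadd[of k "q * k + r"] by (simp add: algebra_simps)
  qed simp
  have "(\<lambda>n. u n / real n) \<longlonglongrightarrow> L"
  proof (rule order_tendstoI)
    fix a assume "a < L"
    then show "\<forall>\<^sub>F n in sequentially. a < u n / real n"
      using lower by (intro eventually_sequentiallyI[of 1]) (meson less_le_trans)
  next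
    fix b assume "L < b"
    then obtain k where k: "k \<ge> 1" "u k / real k < b"
      unfolding L_def using cINF_less_iff[OF _ bdd, of b] by auto
    define M where "M = (\<Sum>r<k. u r)"
    have "(\<lambda>n. u k / real k + M / real n) \<longlonglongrightarrow> u k / real k + 0"
      by (intro tendsto_add tendsto_const lim_const_over_n)
    then have "\<forall>\<^sub>F n in sequentially. u k / real k + M / real n < b"
      using k by (intro order_tendstoD) auto
    moreover have "\<forall>\<^sub>F n in sequentially. u n / real n \<le> u k / real k + M / real n"
    proof (rule eventually_sequentiallyI[of 1])
      fix n :: nat assume n: "1 \<le> n"
      have "n mod k < k" using k by simp
      then have r: "u (n mod k) \<le> M"
        unfolding M_def using nonneg by (intro member_le_sum) auto
      have "real (n div k) * real k \<le> real n"
        by (metis div_times_less_eq_dividend of_nat_le_iff of_nat_mult)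
      then have "real (n div k) \<le> real n / real k" using k by (simp add: field_simps)
      then have "real (n div k) * u k \<le> real n / real k * u k"
        using nonneg by (intro mult_right_mono) auto
      moreover have "u n \<le> real (n div k) * u k + u (n mod k)"
        using mult[of "n div k" k "n mod k"] by simp
      ultimately have "u n \<le> real n / real k * u k + M" using r by linarith
      then show "u n / real n \<le> u k / real k + M / real n"
        using n k by (simp add: field_simps)
    qed
    ultimately show "\<forall>\<^sub>F n in sequentially. u n / real n < b"
      by eventually_elim linarith
  qed
  then show ?thesis by (rule convergentI)
qed

section \<open>Hahn-Banach for real-valued functionals over rational scalars\<close>

locale rat_space = vector_space scale for scale :: "rat \<Rightarrow> 'v::ab_group_add \<Rightarrow> 'v"
begin

definition sublinear :: "('v \<Rightarrow> real) \<Rightarrow> bool" where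
  "sublinear p \<longleftrightarrow> (\<forall>x y. p (x + y) \<le> p x + p y)
     \<and> (\<forall>t x. 0 < t \<longrightarrow> p (scale t x) = of_rat t * p x)"

lemma sublinear_add: "sublinear p \<Longrightarrow> p (x + y) \<le> p x + p y"
  by (simp add: sublinear_def)

lemma sublinear_scale: "sublinear p \<Longrightarrow> 0 < t \<Longrightarrow> p (scale t x) = of_rat t * p x"
  by (simp add: sublinear_def)

lemma sublinear_0: "sublinear p \<Longrightarrow> p 0 = 0"
  using sublinear_scale[of p 2 0] by (simp add: of_rat_numeral_eq)

lemma sublinear_ge: "sublinear p \<Longrightarrow> - p (- x) \<le> p x"
  using sublinear_add[of p x "- x"] sublinear_0[of p] by simp

lemma sublinearI:
  assumes "\<And>x y. p (x + y) \<le> p x + p y"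
    and le: "\<And>t x. 0 < t \<Longrightarrow> p (scale t x) \<le> of_rat t * p x"
  shows "sublinear p"
  unfolding sublinear_def
proof (intro conjI allI impI antisym)
  fix t :: rat and x assume t: "0 < t"
  then show "p (scale t x) \<le> of_rat t * p x" by (rule le)
  have "p (scale (1 / t) (scale t x)) \<le> of_rat (1 / t) * p (scale t x)"
    using t by (intro le) simp
  then show "of_rat t * p x \<le> p (scale t x)"
    using t by (simp add: of_rat_divide field_simps)
qed (rule assms(1))

text \<open>The witness is the infimum over rational t >= 0 of q(x + t a) - t q(a). Taking t = 0
  gives \<open>r \<le> q\<close>, and t = 1 at \<open>- a\<close> gives the last bound. It serves
  both to fix the value at a chosen vector and to show that minimal functionals are odd.\<close>

lemma sublinear_decrease:
  assumes q: "sublinear q"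
  obtains r where "sublinear r" "r \<le> q" "r (- a) \<le> - q a"
proof -
  define f where "f x t = q (x + scale t a) - of_rat t * q a" for x t
  define r where "r x = (INF t\<in>{0..}. f x t)" for x
  \<comment> \<open>A lower bound independent of \<open>t\<close>, so that the infimum is
    finite.\<close>
  have lower: "- q (- x) \<le> f x t" if "t \<ge> 0" for x t
  proof -
    have "of_rat t * q a = q (scale t a)"
      using that sublinear_scale[OF q, of t a] sublinear_0[OF q] by (cases "t = 0") auto
    also have "\<dots> \<le> q (x + scale t a) + q (- x)"
      using sublinear_add[OF q, of "x + scale t a" "- x"] by simp
    finally show ?thesis by (simp add: f_def)
  qed
  have r_le: "r x \<le> f x t" if "t \<ge> 0" for x t
    unfolding r_def using that lower
    by (intro cINF_lower bdd_belowI[of _ "- q (- x)"]) auto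
  have le_r: "b \<le> r x" if "\<And>t. t \<ge> 0 \<Longrightarrow> b \<le> f x t" for b x
    unfolding r_def using that by (intro cINF_greatest) auto
  have "sublinear r"
  proof (rule sublinearI)
    fix x y
    have "r (x + y) \<le> f x t + f y s" if "t \<ge> 0" "s \<ge> 0" for t s
    proof -
      have "r (x + y) \<le> f (x + y) (t + s)" using that by (intro r_le) simp
      also have "\<dots> \<le> f x t + f y s"
        using sublinear_add[OF q, of "x + scale t a" "y + scale s a"]
        by (simp add: f_def scale_left_distrib of_rat_add algebra_simps)
      finally show ?thesis .
    qed
    then have "r (x + y) - f x t \<le> r y" if "t \<ge> 0" for t
      using that by (intro le_r) (simp add: algebra_simps)
    then have "r (x + y) - r y \<le> r x"
      by (intro le_r) (simp add: algebra_simps)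
    then show "r (x + y) \<le> r x + r y" by simp
  next
    fix t :: rat and x assume t: "0 < t"
    have "r (scale t x) / of_rat t \<le> f x s" if "s \<ge> 0" for s
    proof -
      have "r (scale t x) \<le> f (scale t x) (t * s)" using that t by (intro r_le) simp
      also have "\<dots> = of_rat t * f x s"
        using sublinear_scale[OF q t, of "x + scale s a"]
        by (simp add: f_def scale_right_distrib of_rat_mult algebra_simps)
      finally show ?thesis using t by (simp add: field_simps)
    qed
    then have "r (scale t x) / of_rat t \<le> r x" by (rule le_r)
    then show "r (scale t x) \<le> of_rat t * r x" using t by (simp add: field_simps)
  qed
  moreover have "r \<le> q" using r_le[of 0] by (simp add: le_fun_def f_def)
  moreover have "r (- a) \<le> - q a"
    using r_le[of 1 "- a"] sublinear_0[OF q] by (simp add: f_def)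
  ultimately show ?thesis by (rule that)
qed

text \<open>A minimal sublinear functional is additive, so that Zorn's lemma is applied to
  sublinear functionals rather than to partial linear ones.\<close>

theorem hahn_banach:
  assumes p: "sublinear p"
  obtains f where "\<And>x y. f (x + y) = f x + f y" "\<And>x. f x \<le> p x" "f a = p a"
proof -
  \<comment> \<open>Lowering \<open>p\<close> before Zorn's lemma is applied gives every functional
    below \<open>p'\<close> the bound \<open>- p a\<close> at \<open>- a\<close>, which forces the
    value \<open>p a\<close> at \<open>a\<close>.\<close>
  obtain p' where p': "sublinear p'" "p' \<le> p" "p' (- a) \<le> - p a"
    using sublinear_decrease[OF p] .
  define A where "A = {q. sublinear q \<and> q \<le> p'}"
  have "\<exists>m\<in>A. \<forall>q\<in>A. q \<le> m \<longrightarrow> q = m"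
  \<comment> \<open>The order is reversed, so that a maximal element in Zorn's lemma is a minimal
    functional.\<close>
  proof (rule predicate_Zorn[where P = "\<lambda>x y. y \<le> x"])
    show "partial_order_on A (relation_of (\<lambda>x y. y \<le> x) A)"
      by (rule partial_order_on_relation_ofI) auto
  next
    fix C assume C: "C \<in> Chains (relation_of (\<lambda>x y. y \<le> x) A)"
    have CA: "q \<in> A" if "q \<in> C" for q
      using C that by (auto simp: Chains_def relation_of_def)
    have tot: "q \<le> r \<or> r \<le> q" if "q \<in> C" "r \<in> C" for q r
      using C that by (auto simp: Chains_def relation_of_def)
    show "\<exists>u\<in>A. \<forall>q\<in>C. u \<le> q"
    proof (cases "C = {}")
      case True
      then show ?thesis using p' by (auto simp: A_def)
    next
      case False
      define u where "u x = (INF q\<in>C. q x)" for x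
      have lower: "- p' (- x) \<le> q x" if "q \<in> C" for q x
      proof -
        have "- p' (- x) \<le> - q (- x)" using CA[OF that] by (auto simp: A_def le_fun_def)
        also have "\<dots> \<le> q x" using CA[OF that] by (auto simp: A_def intro: sublinear_ge)
        finally show ?thesis .
      qed
      have u_le: "u x \<le> q x" if "q \<in> C" for q x
        unfolding u_def using that lower by (intro cINF_lower bdd_belowI[of _ "- p' (- x)"]) auto
      have le_u: "b \<le> u x" if "\<And>q. q \<in> C \<Longrightarrow> b \<le> q x" for b x
        unfolding u_def using that False by (intro cINF_greatest) auto
      have "sublinear u"
      proof (rule sublinearI)
        fix x y
        \<comment> \<open>The infima at \<open>x\<close> and at \<open>y\<close> are approached by
          different members of the chain; the smaller of the two serves for both.\<close>
        have *: "u (x + y) \<le> q x + r y" if qr: "q \<in> C" "r \<in> C" for q r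
        proof -
          obtain s where s: "s \<in> C" "s \<le> q" "s \<le> r" using tot[OF qr] qr by auto
          have "u (x + y) \<le> s (x + y)" using s by (intro u_le)
          also have "\<dots> \<le> s x + s y" using CA[OF s(1)] by (auto simp: A_def intro: sublinear_add)
          also have "\<dots> \<le> q x + r y" using s by (auto simp: le_fun_def intro: add_mono)
          finally show ?thesis .
        qed
        have "u (x + y) - q x \<le> u y" if "q \<in> C" for q
        proof (rule le_u)
          show "u (x + y) - q x \<le> r y" if "r \<in> C" for r
            using *[OF \<open>q \<in> C\<close> that] by simp
        qed
        then have "u (x + y) - u y \<le> u x" by (intro le_u) (simp add: algebra_simps)
        then show "u (x + y) \<le> u x + u y" by simp
      next
        fix t :: rat and x assume t: "0 < t"
        have "u (scale t x) / of_rat t \<le> q x" if "q \<in> C" for q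
        proof -
          have "u (scale t x) \<le> of_rat t * q x"
            using u_le[OF that, of "scale t x"] CA[OF that] t
            by (auto simp: A_def sublinear_scale)
          then show ?thesis using t by (simp add: field_simps)
        qed
        then have "u (scale t x) / of_rat t \<le> u x" by (rule le_u)
        then show "u (scale t x) \<le> of_rat t * u x" using t by (simp add: field_simps)
      qed
      moreover have "u \<le> p'"
      proof -
        obtain q where "q \<in> C" using False by blast
        then show ?thesis using u_le[of q] CA[of q] by (force simp: A_def le_fun_def intro: order_trans)
      qed
      ultimately show ?thesis using u_le by (auto simp: A_def le_fun_def)
    qed
  qed
  then obtain f where f: "sublinear f" "f \<le> p'"
    and min: "\<And>q. sublinear q \<Longrightarrow> q \<le> f \<Longrightarrow> q = f"
    unfolding A_def by (auto intro: order_trans)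
  \<comment> \<open>The functional decreased at \<open>x\<close> lies below \<open>f\<close>, so by
    minimality it is \<open>f\<close> itself.\<close>
  have neg: "f (- x) \<le> - f x" for x
    using sublinear_decrease[OF f(1), of x] min by metis
  show ?thesis
  proof (rule that)
    fix x y
    have "f x \<le> f (x + y) + f (- y)" using sublinear_add[OF f(1), of "x + y" "- y"] by simp
    then show "f (x + y) = f x + f y"
      using neg[of y] sublinear_add[OF f(1), of x y] by linarith
  next
    show "f x \<le> p x" for x using f(2) p'(2) by (meson le_funD order_trans)
    then have "f a \<le> p a" .
    moreover have "f (- a) \<le> - p a" using f(2) p'(3) by (meson le_funD order_trans)
    ultimately show "f a = p a" using sublinear_ge[OF f(1), of a] by linarith
  qed
qed

end

section \<open>Stable mixed commutator length of lists\<close>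

definition repeat :: "nat \<Rightarrow> 'a list \<Rightarrow> 'a list" where
  "repeat k xs = concat (replicate k xs)"

lemma repeat_0 [simp]: "repeat 0 xs = []"
  by (simp add: repeat_def)

lemma repeat_Suc [simp]: "repeat (Suc k) xs = xs @ repeat k xs"
  by (simp add: repeat_def)

lemma map_repeat: "map f (repeat k xs) = repeat k (map f xs)"
  by (induction k) auto

lemma length_repeat [simp]: "length (repeat k xs) = k * length xs"
  by (induction k) auto

lemma set_repeat: "set (repeat k xs) \<subseteq> set xs"
  by (induction k) auto

lemma count_list_repeat: "count_list (repeat k xs) z = k * count_list xs z"
  by (induction k) auto

lemma mset_repeat_append: "mset (repeat k (xs @ ys)) = mset (repeat k xs @ repeat k ys)"
  by (induction k) auto

context mixed_pair
begin

section \<open>Entrywise powers and inverses, and the cost of combining them\<close>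

definition lpow :: "nat \<Rightarrow> 'a list \<Rightarrow> 'a list" where
  "lpow n xs = map (\<lambda>x. x [^] n) xs"

definition linv :: "'a list \<Rightarrow> 'a list" where
  "linv xs = map (\<lambda>x. inv x) xs"

lemma lpow_simps [simp]:
  "lpow n [] = []" "lpow n (x # xs) = x [^] n # lpow n xs" "lpow n (xs @ ys) = lpow n xs @ lpow n ys"
  "length (lpow n xs) = length xs"
  by (simp_all add: lpow_def)

lemma linv_simps [simp]:
  "linv [] = []" "linv (x # xs) = inv x # linv xs" "linv (xs @ ys) = linv xs @ linv ys"
  "length (linv xs) = length xs"
  by (simp_all add: linv_def)

lemma pow_N [simp]: "x \<in> N \<Longrightarrow> x [^] (n::nat) \<in> N"
  by (induction n) auto

lemma lpow_N [simp]: "set xs \<subseteq> N \<Longrightarrow> set (lpow n xs) \<subseteq> N"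
  by (auto simp: lpow_def)

lemma linv_N [simp]: "set xs \<subseteq> N \<Longrightarrow> set (linv xs) \<subseteq> N"
  by (auto simp: linv_def)

lemma repeat_N [simp]: "set xs \<subseteq> N \<Longrightarrow> set (repeat n xs) \<subseteq> N"
  using set_repeat[of n xs] by blast

lemma lpow_repeat: "lpow n (repeat k xs) = repeat k (lpow n xs)"
  by (simp add: lpow_def map_repeat)

lemma linv_repeat: "linv (repeat k xs) = repeat k (linv xs)"
  by (simp add: linv_def map_repeat)

lemma lpow_linv: "set xs \<subseteq> N \<Longrightarrow> lpow n (linv xs) = linv (lpow n xs)"
  by (induction xs) (auto simp: nat_pow_inv)

lemma linv_linv: "set xs \<subseteq> N \<Longrightarrow> linv (linv xs) = xs"
  by (induction xs) auto

lemma lpow_1: "set xs \<subseteq> N \<Longrightarrow> lpow (Suc 0) xs = xs"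
  by (induction xs) auto

lemma mset_lpow: "mset xs = mset ys \<Longrightarrow> mset (lpow n xs) = mset (lpow n ys)"
  by (simp add: lpow_def)

lemma fills_linv: "fills k xs \<Longrightarrow> fills k (linv xs)"
  unfolding linv_def by (rule fills_inv)

text \<open>One merge per entry: the cost \<open>length xs\<close> involves neither exponent, so scl
  does not see it.\<close>

lemma fills_lpow_merge:
  assumes "set xs \<subseteq> N"
  shows "fills k (lpow n xs @ lpow m xs @ ys) \<Longrightarrow> fills (k + length xs) (lpow (n + m) xs @ ys)"
  using assms
proof (induction xs arbitrary: k ys)
  case (Cons x xs)
  have "fills k (x [^] n # x [^] m # lpow n xs @ lpow m xs @ ys)"
    by (rule fills_perm[OF Cons.prems(1)]) simp
  then have "fills (Suc k) (x [^] (n + m) # lpow n xs @ lpow m xs @ ys)"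
    using fills_merge Cons.prems(2) by (fastforce simp: nat_pow_mult)
  then have "fills (Suc k) (lpow n xs @ lpow m xs @ x [^] (n + m) # ys)"
    by (rule fills_perm) simp
  then have "fills (Suc k + length xs) (lpow (n + m) xs @ x [^] (n + m) # ys)"
    using Cons.prems by (intro Cons.IH) simp_all
  then have "fills (Suc k + length xs) (lpow (n + m) (x # xs) @ ys)"
    by (rule fills_perm) simp
  then show ?case by simp
qed simp

lemma fills_lpow_0: "fills k ys \<Longrightarrow> fills k (lpow 0 xs @ ys)"
  by (induction xs) (auto intro: fills_one)

lemma fills_repeat_lpow_merge:
  assumes "set xs \<subseteq> N"
  shows "fills j (lpow m xs @ repeat k (lpow n xs) @ ys)
    \<Longrightarrow> fills (j + k * length xs) (lpow (m + k * n) xs @ ys)"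
proof (induction k arbitrary: j m)
  case (Suc k)
  then have "fills j (lpow m xs @ lpow n xs @ repeat k (lpow n xs) @ ys)" by simp
  then have "fills (j + length xs) (lpow (m + n) xs @ repeat k (lpow n xs) @ ys)"
    by (rule fills_lpow_merge[OF assms])
  then have "fills (j + length xs + k * length xs) (lpow (m + n + k * n) xs @ ys)"
    by (rule Suc.IH)
  then show ?case by (simp add: add.assoc)
qed simp

text \<open>Merging starts from the trivial entries \<open>lpow 0 xs\<close>, which are free; this
  makes \<open>k\<close> rounds instead of \<open>k - 1\<close>, but the cost still does not depend
  on \<open>n\<close>.\<close>

lemma fills_repeat_lpow:
  "set xs \<subseteq> N \<Longrightarrow> fills j (repeat k (lpow n xs) @ ys) \<Longrightarrow> fills (j + k * length xs) (lpow (k * n) xs @ ys)"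
  using fills_repeat_lpow_merge[of xs j 0 k n ys] fills_lpow_0[of j "repeat k (lpow n xs) @ ys" xs] by simp

lemma fills_repeat: "fills j xs \<Longrightarrow> fills (k * j) (repeat k xs)"
  by (induction k) (auto simp: fills_Nil intro: fills_append)

lemma fills_cancel_list:
  "set zs \<subseteq> N \<Longrightarrow> fills k xs \<Longrightarrow> fills k (xs @ zs @ linv zs)"
proof (induction zs)
  case (Cons z zs)
  then have "fills k (z # inv z # xs @ zs @ linv zs)" by (intro fills_cancel) simp_all
  then show ?case by (rule fills_perm) simp
qed simp

lemma fills_drop_cancel_list:
  "fills k (xs @ zs @ linv zs) \<Longrightarrow> fills (k + length zs) xs"
proof (induction zs arbitrary: k)
  case (Cons z zs)
  then have "fills k (z # inv z # xs @ zs @ linv zs)" by (elim fills_perm) simp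
  then show ?case using Cons.IH[OF fills_drop_cancel] by simp
qed simp

text \<open>By \<open>fills_gprod_iff\<close> these are the lists in \<open>N\<close> whose product
  lies in [G,N]. Only for them is the \<open>LEAST\<close> in \<open>cl\<close> below
  attained.\<close>

definition null :: "'a list \<Rightarrow> bool" where
  "null xs \<longleftrightarrow> (\<exists>k. fills k xs)"

lemma nullI: "fills k xs \<Longrightarrow> null xs"
  by (auto simp: null_def)

lemma null_N: "null xs \<Longrightarrow> set xs \<subseteq> N"
  using fills_N by (auto simp: null_def)

lemma null_lpow:
  assumes "null xs" shows "null (lpow n xs)"
proof -
  obtain k where k: "fills k xs" using assms by (auto simp: null_def)
  then have "fills (n * k) (repeat n (lpow (Suc 0) xs) @ [])"
    using fills_repeat[OF k, of n] by (simp add: lpow_1 fills_N)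
  then show ?thesis using fills_repeat_lpow[OF fills_N[OF k]] nullI by fastforce
qed

lemma null_append: "null xs \<Longrightarrow> null ys \<Longrightarrow> null (xs @ ys)"
  unfolding null_def using fills_append by blast

lemma null_repeat: "null xs \<Longrightarrow> null (repeat k xs)"
  using fills_repeat by (auto simp: null_def)

lemma null_linv: "null xs \<Longrightarrow> null (linv xs)"
  using fills_linv by (auto simp: null_def)

lemma null_perm: "null xs \<Longrightarrow> mset xs = mset ys \<Longrightarrow> null ys"
  using fills_perm by (auto simp: null_def)

definition cl :: "'a list \<Rightarrow> nat" where
  "cl xs = (LEAST k. fills k xs)"

lemma fills_cl: "null xs \<Longrightarrow> fills (cl xs) xs"
  unfolding null_def cl_def by (rule LeastI_ex)

lemma cl_le: "fills k xs \<Longrightarrow> cl xs \<le> k"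
  unfolding cl_def by (rule Least_le)

definition scl :: "'a list \<Rightarrow> real" where
  "scl xs = lim (\<lambda>n. real (cl (lpow n xs)) / real n)"

text \<open>\<open>cl (lpow n xs)\<close> is subadditive in \<open>n\<close> only up to the merging
  cost \<open>length xs\<close>. Adding this constant gives a subadditive sequence with the same
  limiting quotients.\<close>

lemma scl_tendsto:
  assumes "null xs"
  shows "(\<lambda>n. real (cl (lpow n xs)) / real n) \<longlonglongrightarrow> scl xs"
proof -
  define u where "u n = real (cl (lpow n xs) + length xs)" for n
  have "convergent (\<lambda>n. u n / real n)"
  proof (rule subadditive_convergent)
    fix m n
    have "fills (cl (lpow m xs) + cl (lpow n xs)) (lpow m xs @ lpow n xs @ [])"
      using assms by (auto intro: fills_append fills_cl null_lpow)
    then have "fills (cl (lpow m xs) + cl (lpow n xs) + length xs) (lpow (m + n) xs)"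
      using fills_lpow_merge[OF null_N[OF assms], of _ m n "[]"] by simp
    then show "u (m + n) \<le> u m + u n" using cl_le unfolding u_def by fastforce
  qed (simp add: u_def)
  then obtain l where "(\<lambda>n. u n / real n) \<longlonglongrightarrow> l" by (auto simp: convergent_def)
  then have "(\<lambda>n. u n / real n - real (length xs) / real n) \<longlonglongrightarrow> l - 0"
    by (intro tendsto_diff lim_const_over_n)
  then have "(\<lambda>n. real (cl (lpow n xs)) / real n) \<longlonglongrightarrow> l"
    by (simp add: u_def add_divide_distrib)
  then show ?thesis unfolding scl_def by (simp add: limI)
qed

text \<open>The error \<open>C\<close> must not depend on \<open>n\<close>; it then disappears on
  division by \<open>n\<close>. The left side is read along the multiples of \<open>m\<close>, a
  subsequence that determines the limit.\<close>

lemma scl_compare: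
  assumes xs: "null xs" and ys: "null ys" and m: "0 < m"
    and fills: "\<And>n k. fills k (lpow n ys) \<Longrightarrow> fills (k + C) (lpow (m * n) xs)"
  shows "real m * scl xs \<le> scl ys"
proof -
  have "strict_mono (\<lambda>n. m * n)" using m by (auto simp: strict_mono_def)
  from LIMSEQ_subseq_LIMSEQ[OF scl_tendsto[OF xs] this]
  have "(\<lambda>n. real m * (real (cl (lpow (m * n) xs)) / real (m * n))) \<longlonglongrightarrow> real m * scl xs"
    by (intro tendsto_mult tendsto_const) (simp add: o_def)
  then have lhs: "(\<lambda>n. real (cl (lpow (m * n) xs)) / real n) \<longlonglongrightarrow> real m * scl xs"
    using m by simp
  have rhs: "(\<lambda>n. real (cl (lpow n ys)) / real n + real C / real n) \<longlonglongrightarrow> scl ys + 0"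
    by (intro tendsto_add scl_tendsto ys lim_const_over_n)
  have "real (cl (lpow (m * n) xs)) / real n \<le> real (cl (lpow n ys)) / real n + real C / real n" for n
  proof -
    have "cl (lpow (m * n) xs) \<le> cl (lpow n ys) + C"
      by (intro cl_le fills fills_cl null_lpow ys)
    then have "real (cl (lpow (m * n) xs)) \<le> real (cl (lpow n ys)) + real C" by linarith
    then show ?thesis unfolding add_divide_distrib[symmetric] by (rule divide_right_mono) simp
  qed
  then show ?thesis using LIMSEQ_le[OF lhs rhs] by simp
qed

lemma scl_le:
  assumes "null xs" "null ys" "\<And>n k. fills k (lpow n ys) \<Longrightarrow> fills (k + C) (lpow n xs)"
  shows "scl xs \<le> scl ys"
  using scl_compare[of xs ys 1 C] assms by simp

lemma scl_append:
  assumes "null xs" "null ys" shows "scl (xs @ ys) \<le> scl xs + scl ys"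
proof (rule LIMSEQ_le)
  show "(\<lambda>n. real (cl (lpow n (xs @ ys))) / real n) \<longlonglongrightarrow> scl (xs @ ys)"
    by (intro scl_tendsto null_append assms)
  show "(\<lambda>n. real (cl (lpow n xs)) / real n + real (cl (lpow n ys)) / real n) \<longlonglongrightarrow> scl xs + scl ys"
    by (intro tendsto_add scl_tendsto assms)
  have "cl (lpow n (xs @ ys)) \<le> cl (lpow n xs) + cl (lpow n ys)" for n
    using assms by (auto intro!: cl_le fills_append fills_cl null_lpow)
  then have "real (cl (lpow n (xs @ ys))) \<le> real (cl (lpow n xs)) + real (cl (lpow n ys))" for n
    by (metis of_nat_add of_nat_le_iff)
  then show "\<exists>N. \<forall>n\<ge>N. real (cl (lpow n (xs @ ys))) / real n
      \<le> real (cl (lpow n xs)) / real n + real (cl (lpow n ys)) / real n"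
    unfolding add_divide_distrib[symmetric] by (simp add: divide_right_mono)
qed

lemma scl_perm: assumes "null xs" "mset xs = mset ys" shows "scl xs = scl ys"
proof (rule antisym)
  have ys: "null ys" using assms by (rule null_perm)
  show "scl xs \<le> scl ys" "scl ys \<le> scl xs"
    using assms ys mset_lpow[OF assms(2)] by (auto intro!: scl_le[where C = 0] elim!: fills_perm)
qed

lemma scl_linv_le: assumes "null xs" shows "scl (linv xs) \<le> scl xs"
  using assms by (intro scl_le[where C = 0]) (auto simp: null_linv lpow_linv null_N intro: fills_linv)

text \<open>Subadditivity gives the upper bound. For the lower one, \<open>k\<close> copies of the
  \<open>n\<close>-th powers merge into \<open>(k * n)\<close>-th powers at a cost independent of
  \<open>n\<close>.\<close>

lemma scl_repeat: assumes "null xs" shows "scl (repeat k xs) = real k * scl xs"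
proof (rule antisym)
  show "scl (repeat k xs) \<le> real k * scl xs"
  proof (induction k)
    case 0
    have "cl [] = 0" using cl_le[OF fills_Nil] by simp
    then show ?case by (simp add: scl_def lim_const)
  next
    case (Suc k)
    then show ?case using scl_append[OF assms null_repeat[OF assms, of k]] by (simp add: algebra_simps)
  qed
  show "real k * scl xs \<le> scl (repeat k xs)"
  proof (cases "k = 0")
    case True
    have "cl [] = 0" using cl_le[OF fills_Nil] by simp
    then show ?thesis using True by (simp add: scl_def lim_const)
  next
    case False
    then show ?thesis
      using assms fills_repeat_lpow[OF null_N[OF assms], of _ k _ "[]"]
      by (intro scl_compare[where C = "k * length xs"]) (auto simp: null_repeat lpow_repeat)
  qed
qed

text \<open>Inserting the pairs is free and deleting them costs at most \<open>length zs\<close> for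
  every exponent. This permits comparing different lists that represent the same chain.\<close>

lemma scl_cancel:
  assumes "null xs" "set zs \<subseteq> N"
  shows "scl (xs @ zs @ linv zs) = scl xs" "null (xs @ zs @ linv zs)"
proof -
  show *: "null (xs @ zs @ linv zs)"
    using assms fills_cancel_list unfolding null_def by blast
  show "scl (xs @ zs @ linv zs) = scl xs"
  proof (rule antisym)
    show "scl (xs @ zs @ linv zs) \<le> scl xs"
      using assms * fills_cancel_list[of "lpow _ zs"]
      by (intro scl_le[where C = 0]) (auto simp: lpow_linv)
    show "scl xs \<le> scl (xs @ zs @ linv zs)"
      using assms * fills_drop_cancel_list[of _ _ "lpow _ zs"]
      by (intro scl_le[where C = "length zs"]) (auto simp: lpow_linv)
  qed
qed

lemma scl_le_0:
  assumes "\<And>n. fills C (lpow n xs)" "set xs \<subseteq> N" shows "scl xs \<le> 0"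
proof -
  have "null xs" using assms(1)[of "Suc 0"] assms(2) by (metis lpow_1 nullI)
  then have "scl xs \<le> scl []"
    using fills_mono[OF assms(1)] nullI[OF fills_Nil] by (intro scl_le[where C = C]) auto
  moreover have "cl [] = 0" using cl_le[OF fills_Nil] by simp
  ultimately show ?thesis by (simp add: scl_def lim_const)
qed

text \<open>This is the boundary chain a + b - ab. At the odd exponents \<open>2 * k + 1\<close> the
  length is at most \<open>k\<close>, and a subsequence suffices since the limit is known to
  exist.\<close>

lemma pair_of_pants:
  assumes a: "a \<in> N" and b: "b \<in> N"
  shows "null [inv (a \<otimes> b), a, b]" "scl [inv (a \<otimes> b), a, b] \<le> 1 / 2"
proof -
  let ?xs = "[inv (a \<otimes> b), a, b]"
  have "lpow n ?xs = [inv ((a \<otimes> b) [^] n), a [^] n, b [^] n]" for n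
    using a b by (simp add: nat_pow_inv)
  then have fills: "fills k (lpow (2 * k + 1) ?xs)" for k
    using fills_odd_power[OF a b refl, of k] by presburger
  have "lpow (Suc 0) ?xs = ?xs" using a b by (intro lpow_1) auto
  then show null: "null ?xs" using fills[of 0] by (metis nullI Suc_eq_plus1 mult_0_right)
  have "strict_mono (\<lambda>k::nat. 2 * k + 1)" by (auto simp: strict_mono_def)
  from LIMSEQ_subseq_LIMSEQ[OF scl_tendsto[OF null] this]
  have lim: "(\<lambda>k. real (cl (lpow (2 * k + 1) ?xs)) / real (2 * k + 1)) \<longlonglongrightarrow> scl ?xs"
    by (simp add: o_def)
  have "real (cl (lpow (2 * k + 1) ?xs)) / real (2 * k + 1) \<le> 1 / 2" for k
  proof -
    have "real (cl (lpow (2 * k + 1) ?xs)) \<le> real k" using cl_le[OF fills] by (simp only: of_nat_le_iff)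
    then show ?thesis by (simp only: of_nat_add of_nat_mult) (simp add: field_simps)
  qed
  then show "scl ?xs \<le> 1 / 2" by (intro LIMSEQ_le_const2[OF lim]) auto
qed

end

section \<open>Duality\<close>

definition chain_scale :: "rat \<Rightarrow> ('a \<Rightarrow> rat) \<Rightarrow> 'a \<Rightarrow> rat" where
  "chain_scale r c = (\<lambda>z. r * c z)"

lemma chain_scale_apply [simp]: "chain_scale r c z = r * c z"
  by (simp add: chain_scale_def)

interpretation chains: rat_space chain_scale
  by unfold_locales (auto simp: fun_eq_iff algebra_simps)

text \<open>Composition with a projection extends a sublinear functional from a subspace to all
  functions, so Hahn-Banach can be stated on a whole type.\<close>

lemma chain_projection:
  assumes "chains.subspace B"
  obtains g where "\<And>c. g c \<in> B" "\<And>c. c \<in> B \<Longrightarrow> g c = c"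
    "\<And>c d. g (c + d) = g c + g d" "\<And>r c. g (chain_scale r c) = chain_scale r (g c)"
proof -
  interpret vector_space_pair chain_scale chain_scale by unfold_locales
  have "\<exists>g. range g \<subseteq> B \<and> Vector_Spaces.linear chain_scale chain_scale g \<and> (\<forall>c\<in>B. g (id c) = c)"
    using assms by (intro linear_exists_left_inverse_on chains.linear_id) auto
  then obtain g where g: "range g \<subseteq> B" "Vector_Spaces.linear chain_scale chain_scale g" "\<forall>c\<in>B. g c = c"
    by auto
  interpret g: Vector_Spaces.linear chain_scale chain_scale g by (rule g(2))
  show ?thesis
    using g(1,3) by (intro that[of g]) (auto simp: g.add g.scale)
qed

definition cnt :: "'a list \<Rightarrow> 'a \<Rightarrow> rat" where
  "cnt xs z = of_nat (count_list xs z)"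

lemma cnt_Nil [simp]: "cnt [] = 0"
  by (simp add: cnt_def fun_eq_iff)

lemma cnt_Cons: "cnt (x # xs) = cnt [x] + cnt xs"
  by (auto simp: cnt_def fun_eq_iff)

lemma cnt_append: "cnt (xs @ ys) = cnt xs + cnt ys"
  by (auto simp: cnt_def fun_eq_iff)

lemma cnt_repeat: "cnt (repeat k xs) = chain_scale (of_nat k) (cnt xs)"
  by (auto simp: cnt_def fun_eq_iff count_list_repeat)

lemma cnt_eq_iff: "cnt xs = cnt ys \<longleftrightarrow> mset xs = mset ys"
  by (auto simp: cnt_def fun_eq_iff multiset_eq_iff count_mset)

lemma sup0_eqI:
  assumes "r \<in> S" "\<And>x. x \<in> S \<Longrightarrow> x \<le> r" shows "sup0 S = ereal r"
proof -
  have "Sup (ereal ` S) = ereal r"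
    using assms by (intro antisym Sup_least Sup_upper) auto
  then show ?thesis using assms(1) by (auto simp: sup0_def)
qed

text \<open>The empty set is included through the convention in \<open>sup0\<close>, so the
  degenerate case of the duality needs no separate treatment of it.\<close>

lemma sup0_const: "(\<And>x. x \<in> S \<Longrightarrow> x = 0) \<Longrightarrow> sup0 S = ereal 0"
proof (cases "S = {}")
  case False
  assume "\<And>x. x \<in> S \<Longrightarrow> x = 0"
  with False have "S = {0}" by blast
  then show ?thesis by (intro sup0_eqI) auto
qed (simp add: sup0_def)

context mixed_pair
begin

lemma one_N: "\<one> \<in> N"
  by (rule subgroup.one_closed[OF is_subgroup])

text \<open>The multiplier \<open>m\<close> is part of the data, so that clearing denominators and
  splitting into positive and negative entries are handled together.\<close>

definition represents :: "nat \<Rightarrow> ('a \<Rightarrow> rat) \<Rightarrow> 'a list \<Rightarrow> 'a list \<Rightarrow> bool" where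
  "represents m c xs ys \<longleftrightarrow> 0 < m \<and> set xs \<subseteq> N \<and> set ys \<subseteq> N \<and> null (xs @ linv ys) \<and>
     chain_scale (of_nat m) c = cnt xs - cnt ys"

text \<open>Cross-multiplication puts both representations over \<open>m * m'\<close>. As chains the
  resulting lists agree, and they become permutations of each other after cancelling pairs are added
  to both.\<close>

lemma represents_unique:
  assumes 1: "represents m c xs ys" and 2: "represents m' c xs' ys'"
  shows "real m' * scl (xs @ linv ys) = real m * scl (xs' @ linv ys')"
proof -
  have sub: "set xs \<subseteq> N" "set ys \<subseteq> N" "set xs' \<subseteq> N" "set ys' \<subseteq> N"
    and null: "null (xs @ linv ys)" "null (xs' @ linv ys')"
    using 1 2 by (auto simp: represents_def)
  have c1: "chain_scale (of_nat m) c = cnt xs - cnt ys"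
    and c2: "chain_scale (of_nat m') c = cnt xs' - cnt ys'"
    using 1 2 by (auto simp: represents_def)
  have "cnt (repeat m' xs @ repeat m ys') = cnt (repeat m xs' @ repeat m' ys)"
  proof
    fix z
    have "of_nat m * c z = cnt xs z - cnt ys z" "of_nat m' * c z = cnt xs' z - cnt ys' z"
      using fun_cong[OF c1, of z] fun_cong[OF c2, of z] by simp_all
    then have "of_nat m' * (cnt xs z - cnt ys z) = of_nat m * (cnt xs' z - cnt ys' z)"
      by (metis mult.left_commute)
    then show "cnt (repeat m' xs @ repeat m ys') z = cnt (repeat m xs' @ repeat m' ys) z"
      by (simp add: cnt_append cnt_repeat algebra_simps)
  qed
  then have m: "mset (repeat m' xs) + mset (repeat m ys') = mset (repeat m xs') + mset (repeat m' ys)"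
    by (simp add: cnt_eq_iff)
  let ?P = "repeat m' xs @ linv (repeat m' ys)" and ?Q = "repeat m xs' @ linv (repeat m ys')"
  have P: "null ?P" "scl ?P = real m' * scl (xs @ linv ys)"
    using null_perm[OF null_repeat[OF null(1)] mset_repeat_append]
      scl_perm[OF null_repeat[OF null(1)] mset_repeat_append, of m'] scl_repeat[OF null(1), of m']
    by (simp_all add: linv_repeat)
  have Q: "null ?Q" "scl ?Q = real m * scl (xs' @ linv ys')"
    using null_perm[OF null_repeat[OF null(2)] mset_repeat_append]
      scl_perm[OF null_repeat[OF null(2)] mset_repeat_append, of m] scl_repeat[OF null(2), of m]
    by (simp_all add: linv_repeat)
  \<comment> \<open>Each side receives the negative entries of the other, together with their
    inverses.\<close>
  have "scl ?P = scl (?P @ repeat m ys' @ linv (repeat m ys'))"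
    using scl_cancel(1)[OF P(1), of "repeat m ys'"] sub by simp
  also have "\<dots> = scl (?Q @ repeat m' ys @ linv (repeat m' ys))"
  proof (rule scl_perm)
    show "null (?P @ repeat m ys' @ linv (repeat m ys'))"
      using scl_cancel(2)[OF P(1), of "repeat m ys'"] sub by simp
    have "mset (?P @ repeat m ys' @ linv (repeat m ys'))
        = (mset (repeat m' xs) + mset (repeat m ys')) + (mset (linv (repeat m' ys)) + mset (linv (repeat m ys')))"
      by (simp add: ac_simps)
    also have "\<dots> = mset (?Q @ repeat m' ys @ linv (repeat m' ys))"
      unfolding m by (simp add: ac_simps)
    finally show "mset (?P @ repeat m ys' @ linv (repeat m ys')) = mset (?Q @ repeat m' ys @ linv (repeat m' ys))" .
  qed
  also have "\<dots> = scl ?Q"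
    using scl_cancel(1)[OF Q(1), of "repeat m' ys"] sub by simp
  finally show ?thesis using P Q by simp
qed

definition null_chains :: "('a \<Rightarrow> rat) set" where
  "null_chains = {c. \<exists>m xs ys. represents m c xs ys}"

text \<open>The choice is harmless on \<open>null_chains\<close> by
  \<open>represents_unique\<close>. Elsewhere the value is arbitrary, hence the projection in
  \<open>exists_extremal\<close>.\<close>

definition chain_scl :: "('a \<Rightarrow> rat) \<Rightarrow> real" where
  "chain_scl c = (SOME r. \<exists>m xs ys. represents m c xs ys \<and> r = scl (xs @ linv ys) / real m)"

lemma chain_scl_eq:
  assumes "represents m c xs ys" shows "chain_scl c = scl (xs @ linv ys) / real m"
proof -
  have "\<exists>m xs ys. represents m c xs ys \<and> chain_scl c = scl (xs @ linv ys) / real m"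
    unfolding chain_scl_def by (rule someI_ex) (use assms in blast)
  then obtain m' xs' ys' where *: "represents m' c xs' ys'" "chain_scl c = scl (xs' @ linv ys') / real m'"
    by blast
  then have "m > 0" "m' > 0" using assms by (auto simp: represents_def)
  have "real m' * (real m * chain_scl c) = real m' * scl (xs @ linv ys)"
    using represents_unique[OF assms *(1)] \<open>m' > 0\<close> unfolding *(2) by simp
  then show ?thesis using \<open>m > 0\<close> \<open>m' > 0\<close> by (simp add: field_simps)
qed

lemma represents_add:
  assumes 1: "represents m c xs ys" and 2: "represents m' c' xs' ys'"
  shows "represents (m * m') (c + c') (repeat m' xs @ repeat m xs') (repeat m' ys @ repeat m ys')"
    and "chain_scl (c + c') \<le> chain_scl c + chain_scl c'"
proof -
  have sub: "set xs \<subseteq> N" "set ys \<subseteq> N" "set xs' \<subseteq> N" "set ys' \<subseteq> N" and m: "m > 0" "m' > 0"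
    and null: "null (xs @ linv ys)" "null (xs' @ linv ys')"
    using 1 2 by (auto simp: represents_def)
  have c1: "chain_scale (of_nat m) c = cnt xs - cnt ys"
    and c2: "chain_scale (of_nat m') c' = cnt xs' - cnt ys'"
    using 1 2 by (auto simp: represents_def)
  let ?P = "repeat m' (xs @ linv ys) @ repeat m (xs' @ linv ys')"
  let ?X = "repeat m' xs @ repeat m xs'" and ?Y = "repeat m' ys @ repeat m ys'"
  have P: "null ?P" by (rule null_append[OF null_repeat null_repeat, OF null])
  have perm: "mset ?P = mset (?X @ linv ?Y)"
    using mset_repeat_append[of m' xs "linv ys"] mset_repeat_append[of m xs' "linv ys'"]
    by (simp add: linv_repeat ac_simps)
  have "chain_scale (of_nat (m * m')) (c + c') = cnt ?X - cnt ?Y"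
  proof
    fix z
    have "of_nat m * c z = cnt xs z - cnt ys z" "of_nat m' * c' z = cnt xs' z - cnt ys' z"
      using fun_cong[OF c1, of z] fun_cong[OF c2, of z] by simp_all
    moreover have "of_nat (m * m') * (c z + c' z) = of_nat m' * (of_nat m * c z) + of_nat m * (of_nat m' * c' z)"
      by (simp add: algebra_simps)
    ultimately have "of_nat (m * m') * (c z + c' z) = of_nat m' * (cnt xs z - cnt ys z) + of_nat m * (cnt xs' z - cnt ys' z)"
      by simp
    then show "chain_scale (of_nat (m * m')) (c + c') z = (cnt ?X - cnt ?Y) z"
      by (simp add: cnt_append cnt_repeat algebra_simps)
  qed
  then show r: "represents (m * m') (c + c') ?X ?Y"
    using m sub null_perm[OF P perm] unfolding represents_def by simp
  have "scl (?X @ linv ?Y) = scl ?P" using scl_perm[OF P perm] by simp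
  also have "\<dots> \<le> real m' * scl (xs @ linv ys) + real m * scl (xs' @ linv ys')"
    using scl_append[OF null_repeat[OF null(1)] null_repeat[OF null(2)], of m' m] by (simp add: scl_repeat null)
  finally show "chain_scl (c + c') \<le> chain_scl c + chain_scl c'"
    unfolding chain_scl_eq[OF 1] chain_scl_eq[OF 2] chain_scl_eq[OF r]
    using m by (simp add: field_simps)
qed

lemma represents_scale:
  assumes 1: "represents m c xs ys" and t: "0 < t"
  shows "\<exists>k xs ys. represents k (chain_scale t c) xs ys"
    and "chain_scl (chain_scale t c) = of_rat t * chain_scl c"
proof -
  have sub: "set xs \<subseteq> N" "set ys \<subseteq> N" and m: "m > 0" and null: "null (xs @ linv ys)"
    and c: "chain_scale (of_nat m) c = cnt xs - cnt ys"
    using 1 by (auto simp: represents_def)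
  obtain p q where pq: "quotient_of t = (p, q)" by fastforce
  define a b where "a = nat p" and "b = nat q"
  have q: "q > 0" using quotient_of_denom_pos[OF pq] .
  have tpq: "t = of_int p / of_int q" using quotient_of_div[OF pq] .
  then have "p > 0" using t q by (simp add: zero_less_divide_iff)
  then have t_eq: "t = of_nat a / of_nat b" and b: "b > 0"
    using q tpq by (auto simp: a_def b_def)
  let ?P = "repeat a (xs @ linv ys)"
  have perm: "mset ?P = mset (repeat a xs @ linv (repeat a ys))"
    using mset_repeat_append[of a xs "linv ys"] by (simp add: linv_repeat)
  have "chain_scale (of_nat (m * b)) (chain_scale t c) = cnt (repeat a xs) - cnt (repeat a ys)"
  proof
    fix z
    have *: "of_nat m * c z = cnt xs z - cnt ys z"
      using fun_cong[OF c, of z] by simp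
    have "of_nat (m * b) * (t * c z) = of_nat a * (of_nat m * c z)"
      using b by (simp add: t_eq)
    then show "chain_scale (of_nat (m * b)) (chain_scale t c) z = (cnt (repeat a xs) - cnt (repeat a ys)) z"
      unfolding * by (simp add: cnt_repeat algebra_simps)
  qed
  then have r: "represents (m * b) (chain_scale t c) (repeat a xs) (repeat a ys)"
    using m b sub null_perm[OF null_repeat[OF null] perm] unfolding represents_def by simp
  then show "\<exists>k xs ys. represents k (chain_scale t c) xs ys" by blast
  have "scl (repeat a xs @ linv (repeat a ys)) = real a * scl (xs @ linv ys)"
    using scl_perm[OF null_repeat[OF null] perm] scl_repeat[OF null] by simp
  then show "chain_scl (chain_scale t c) = of_rat t * chain_scl c"
    unfolding chain_scl_eq[OF 1] chain_scl_eq[OF r]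
    using m b by (simp add: t_eq of_rat_divide field_simps)
qed

lemma mset_linv_swap: "set ys \<subseteq> N \<Longrightarrow> mset (linv (xs @ linv ys)) = mset (ys @ linv xs)"
  by (simp add: linv_linv)

lemma null_swap:
  assumes "null (xs @ linv ys)" "set ys \<subseteq> N" shows "null (ys @ linv xs)"
  using null_perm[OF null_linv[OF assms(1)] mset_linv_swap[OF assms(2)]] .

lemma scl_swap_le:
  assumes "null (xs @ linv ys)" "set ys \<subseteq> N" shows "scl (ys @ linv xs) \<le> scl (xs @ linv ys)"
proof -
  have "scl (linv (xs @ linv ys)) = scl (ys @ linv xs)"
    by (rule scl_perm[OF null_linv[OF assms(1)] mset_linv_swap[OF assms(2)]])
  then show ?thesis using scl_linv_le[OF assms(1)] by simp
qed

lemma represents_minus: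
  assumes "represents m c xs ys" shows "represents m (- c) ys xs"
proof -
  have *: "chain_scale (of_nat m) c = cnt xs - cnt ys" using assms by (simp add: represents_def)
  have "chain_scale (of_nat m) (- c) = cnt ys - cnt xs"
    using fun_cong[OF *] by (simp add: fun_eq_iff)
  then show ?thesis using assms null_swap by (simp add: represents_def)
qed

lemma null_chains_subspace: "chains.subspace null_chains"
proof (rule chains.subspaceI)
  have "represents 1 0 [] []"
    by (simp add: represents_def nullI[OF fills_Nil])
  then show "0 \<in> null_chains" unfolding null_chains_def by blast
  show "c + d \<in> null_chains" if "c \<in> null_chains" "d \<in> null_chains" for c d
    using that represents_add(1) unfolding null_chains_def by blast
  show "chain_scale t c \<in> null_chains" if c: "c \<in> null_chains" for t c
  proof -
    consider "t > 0" | "t = 0" | "t < 0" by linarith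
    then show ?thesis
    proof cases
      case 1
      then show ?thesis using c represents_scale(1) unfolding null_chains_def by blast
    next
      case 2
      then show ?thesis using \<open>0 \<in> null_chains\<close> by simp
    next
      case 3
      have "- c \<in> null_chains" using c represents_minus unfolding null_chains_def by blast
      then have "chain_scale (- t) (- c) \<in> null_chains"
        using 3 represents_scale(1)[of _ "- c" _ _ "- t"] unfolding null_chains_def by auto
      then show ?thesis by simp
    qed
  qed
qed

section \<open>Relations with vanishing scl: inverses, conjugates and powers\<close>

lemma conj_pow:
  assumes "g \<in> carrier G" "x \<in> carrier G"
  shows "conj g x [^] (n::nat) = conj g (x [^] n)"
  by (induction n) (use assms in \<open>simp_all add: group_simps\<close>)

lemma scl_cancel_pair:
  assumes "x \<in> N" shows "null [x, inv x]" "scl [x, inv x] \<le> 0"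
  using scl_cancel[OF nullI[OF fills_Nil], of "[x]"] scl_le_0[of 0 "[]"] assms
  by (simp_all add: fills_Nil)

lemma scl_conj_pair:
  assumes x: "x \<in> N" and g: "g \<in> carrier G"
  shows "null [conj g x, inv x]" "scl [conj g x, inv x] \<le> 0"
proof -
  have f: "fills 0 (lpow n [conj g x, inv x])" for n
    using fills_conj[OF fills_cancel[OF fills_Nil, of "x [^] n"] g] x g
    by (simp add: conj_pow nat_pow_inv)
  then show "scl [conj g x, inv x] \<le> 0" using x g by (intro scl_le_0) auto
  show "null [conj g x, inv x]" using f[of "Suc 0"] x g by (simp add: nullI)
qed

text \<open>Merging the \<open>k\<close> copies of \<open>x [^] n\<close> into one entry costs at
  most \<open>k\<close> commutators, whatever \<open>n\<close> is; a bounded cost forces scl to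
  vanish.\<close>

lemma scl_power:
  assumes x: "x \<in> N"
  shows "null ([x [^] k] @ linv (repeat k [x]))" "scl ([x [^] k] @ linv (repeat k [x])) \<le> 0"
proof -
  let ?xs = "[x [^] k] @ linv (repeat k [x])"
  have sub: "set ?xs \<subseteq> N" using x linv_N[OF repeat_N, of "[x]" k] by simp
  have f: "fills k (lpow n ?xs)" for n
  proof -
    have r: "repeat k [x [^] n] = repeat k (lpow n [x])" by simp
    have "fills 0 ([] @ repeat k [x [^] n] @ linv (repeat k [x [^] n]))"
      using x repeat_N[of "[x [^] n]" k] by (intro fills_cancel_list fills_Nil) auto
    then have "fills 0 (repeat k (lpow n [x]) @ linv (repeat k [x [^] n]))" by simp
    then have "fills (0 + k * length [x]) (lpow (k * n) [x] @ linv (repeat k [x [^] n]))"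
      using x by (intro fills_repeat_lpow) auto
    moreover have "lpow (k * n) [x] @ linv (repeat k [x [^] n]) = lpow n ?xs"
      using x lpow_linv[OF repeat_N, of "[x]" n k] by (simp add: lpow_repeat nat_pow_pow)
    ultimately show ?thesis by simp
  qed
  then show "scl ?xs \<le> 0" using sub by (intro scl_le_0)
  show "null ?xs" using f[of "Suc 0"] sub by (metis lpow_1 nullI)
qed

lemma exists_extremal:
  assumes sub: "set xs \<subseteq> N" "set ys \<subseteq> N" and null: "null (xs @ linv ys)"
  obtains \<mu> where "\<mu> \<in> inv_hqm G N" "defect G N \<mu> \<le> 1 / 2"
    "sum_list (map \<mu> xs) - sum_list (map \<mu> ys) = scl (xs @ linv ys)"
proof -
  obtain g where g: "\<And>c. g c \<in> null_chains" "\<And>c. c \<in> null_chains \<Longrightarrow> g c = c"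
    "\<And>c d. g (c + d) = g c + g d" "\<And>r c. g (chain_scale r c) = chain_scale r (g c)"
    using chain_projection[OF null_chains_subspace] by blast
  have "chains.sublinear (\<lambda>c. chain_scl (g c))"
    unfolding chains.sublinear_def
  proof (intro conjI allI impI)
    fix c d
    obtain m xs ys m' xs' ys' where "represents m (g c) xs ys" "represents m' (g d) xs' ys'"
      using g(1) unfolding null_chains_def by blast
    then show "chain_scl (g (c + d)) \<le> chain_scl (g c) + chain_scl (g d)"
      unfolding g(3) by (rule represents_add(2))
  next
    fix t :: rat and c assume "0 < t"
    moreover obtain m xs ys where "represents m (g c) xs ys"
      using g(1) unfolding null_chains_def by blast
    ultimately show "chain_scl (g (chain_scale t c)) = of_rat t * chain_scl (g c)"
      unfolding g(4) by (intro represents_scale(2))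
  qed
  then obtain f where f_add: "\<And>c d. f (c + d) = f c + f d" and f_le: "\<And>c. f c \<le> chain_scl (g c)"
    and f_eq: "f (cnt xs - cnt ys) = chain_scl (g (cnt xs - cnt ys))"
    using chains.hahn_banach[where a = "cnt xs - cnt ys"] by blast
  have f_0: "f 0 = 0" using f_add[of 0 0] by simp
  have f_diff: "f (c - d) = f c - f d" for c d using f_add[of "c - d" d] by simp
  define \<mu> where "\<mu> x = f (cnt [x])" for x
  have f_cnt: "f (cnt zs) = sum_list (map \<mu> zs)" for zs
  proof (induction zs)
    case (Cons z zs)
    have "f (cnt (z # zs)) = \<mu> z + f (cnt zs)"
      unfolding \<mu>_def f_add[symmetric] by (rule arg_cong[OF cnt_Cons])
    then show ?case using Cons by simp
  qed (simp only: cnt_Nil f_0 list.map sum_list.Nil)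
  have rep1: "represents 1 (cnt zs - cnt ws) zs ws"
    if "null (zs @ linv ws)" "set ws \<subseteq> N" for zs ws
    using that null_N[OF that(1)] by (simp add: represents_def fun_eq_iff)
  have gid: "chain_scl (g (cnt zs - cnt ws)) = scl (zs @ linv ws)"
    if "null (zs @ linv ws)" "set ws \<subseteq> N" for zs ws
  proof -
    have "cnt zs - cnt ws \<in> null_chains" using rep1[OF that] unfolding null_chains_def by blast
    then show ?thesis using chain_scl_eq[OF rep1[OF that]] g(2) by simp
  qed
  have upper: "sum_list (map \<mu> zs) - sum_list (map \<mu> ws) \<le> scl (zs @ linv ws)"
    if "null (zs @ linv ws)" "set ws \<subseteq> N" for zs ws
    using f_le[of "cnt zs - cnt ws"] gid[OF that] by (simp add: f_diff f_cnt)
  \<comment> \<open>The estimate becomes two-sided because exchanging the positive and negative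
    entries does not increase scl.\<close>
  have bound: "\<bar>sum_list (map \<mu> zs) - sum_list (map \<mu> ws)\<bar> \<le> r"
    if "null (zs @ linv ws)" "set ws \<subseteq> N" "scl (zs @ linv ws) \<le> r" for zs ws r
    using upper[OF that(1,2)] upper[OF null_swap[OF that(1,2)]] scl_swap_le[OF that(1,2)] that
      null_N[OF that(1)] by (auto simp: abs_le_iff)
  have qm: "\<bar>\<mu> (a \<otimes> b) - \<mu> a - \<mu> b\<bar> \<le> 1 / 2" if "a \<in> N" "b \<in> N" for a b
  proof -
    have p: "mset [inv (a \<otimes> b), a, b] = mset ([a, b] @ linv [a \<otimes> b])" by simp
    show ?thesis
      using bound[of "[a, b]" "[a \<otimes> b]" "1 / 2"] pair_of_pants[OF that] that
        null_perm[OF _ p] scl_perm[OF _ p] by (simp add: abs_minus_commute algebra_simps)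
  qed
  have inv: "\<mu> (inv x) = - \<mu> x" if "x \<in> N" for x
    using bound[of "[x, inv x]" "[]" 0] scl_cancel_pair[OF that] by simp
  have pow: "\<mu> (x [^] k) = real k * \<mu> x" if "x \<in> N" for x and k :: nat
  proof -
    have "sum_list (map \<mu> (repeat k [x])) = real k * \<mu> x" by (induction k) (auto simp: algebra_simps)
    then show ?thesis
      using bound[OF scl_power(1)[OF that] _ scl_power(2)[OF that], of k] that repeat_N[of "[x]" k] by simp
  qed
  have "\<mu> (x [^] n) = of_int n * \<mu> x" if "x \<in> N" for x and n :: int
    by (cases n rule: int_cases2) (use that pow inv in \<open>simp_all add: int_pow_int int_pow_neg_int\<close>)
  moreover have "\<mu> (conj h x) = \<mu> x" if "x \<in> N" "h \<in> carrier G" for x h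
    using bound[of "[conj h x]" "[x]" 0] scl_conj_pair[OF that] that by simp
  moreover have "bdd_above {\<bar>\<mu> (h1 \<otimes> h2) - \<mu> h1 - \<mu> h2\<bar> | h1 h2. h1 \<in> N \<and> h2 \<in> N}"
    using qm by (intro bdd_aboveI[of _ "1 / 2"]) auto
  ultimately have "\<mu> \<in> inv_hqm G N" by (simp add: inv_hqm_def)
  moreover have "defect G N \<mu> \<le> 1 / 2"
    unfolding defect_def using qm one_N by (intro cSup_least) blast+
  moreover have "sum_list (map \<mu> xs) - sum_list (map \<mu> ys) = scl (xs @ linv ys)"
    using f_eq gid[OF null sub(2)] by (simp add: f_diff f_cnt)
  ultimately show ?thesis by (rule that)
qed

section \<open>Invariant homogeneous quasimorphisms are bounded by scl\<close>

context
  fixes \<mu> :: "'a \<Rightarrow> real"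
  assumes \<mu>: "\<mu> \<in> inv_hqm G N"
begin

lemma hqm_defect: "a \<in> N \<Longrightarrow> b \<in> N \<Longrightarrow> \<bar>\<mu> (a \<otimes> b) - \<mu> a - \<mu> b\<bar> \<le> defect G N \<mu>"
  unfolding defect_def using \<mu> by (intro cSup_upper) (auto simp: inv_hqm_def)

lemma defect_nonneg: "0 \<le> defect G N \<mu>"
  using hqm_defect[of \<one> \<one>] by simp

lemma hqm_int_pow: "x \<in> N \<Longrightarrow> \<mu> (x [^] n) = of_int n * \<mu> x" for n :: int
  using \<mu> by (simp add: inv_hqm_def)

lemma hqm_one: "\<mu> \<one> = 0"
  using hqm_int_pow[of \<one> 0] by simp

lemma hqm_pow: "x \<in> N \<Longrightarrow> \<mu> (x [^] n) = real n * \<mu> x" for n :: nat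
  using hqm_int_pow[of x "int n"] by (simp add: int_pow_int)

lemma hqm_inv: "x \<in> N \<Longrightarrow> \<mu> (inv x) = - \<mu> x"
  using hqm_int_pow[of x "- 1"] by (simp add: int_pow_neg)

lemma hqm_conj: "g \<in> carrier G \<Longrightarrow> x \<in> N \<Longrightarrow> \<mu> (conj g x) = \<mu> x"
  using \<mu> by (simp add: inv_hqm_def)

text \<open>By invariance the values at \<open>conj g x\<close> and \<open>inv x\<close> cancel, so
  only the defect of their product remains.\<close>

lemma hqm_mixed_comm:
  assumes "c \<in> mixed_comms G N" shows "\<bar>\<mu> c\<bar> \<le> defect G N \<mu>"
proof -
  obtain g x where gx: "g \<in> carrier G" "x \<in> N" "c = conj g x \<otimes> inv x"
    using assms unfolding mixed_comms_def gcomm_def by blast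
  have "\<bar>\<mu> c - \<mu> (conj g x) - \<mu> (inv x)\<bar> \<le> defect G N \<mu>"
    unfolding gx(3) using gx(1,2) by (intro hqm_defect) simp_all
  then show ?thesis unfolding hqm_conj[OF gx(1,2)] hqm_inv[OF gx(2)] by simp
qed

text \<open>Each commutator contributes one defect for its value and one for the multiplication;
  this is the origin of the 2 in 2 D(mu).\<close>

lemma hqm_mprods: "u \<in> mprods k \<Longrightarrow> \<bar>\<mu> u\<bar> \<le> 2 * real k * defect G N \<mu>"
proof (induction k arbitrary: u)
  case (Suc k)
  then obtain c w where *: "c \<in> mixed_comms G N" "w \<in> mprods k" "u = c \<otimes> w"
    by (auto simp: mprods_Suc)
  have "\<bar>\<mu> u\<bar> \<le> \<bar>\<mu> c\<bar> + \<bar>\<mu> w\<bar> + defect G N \<mu>"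
    using hqm_defect[OF mixed_comms_N[OF *(1)] mprods_N[OF *(2)]] unfolding *(3) by linarith
  also have "\<dots> \<le> 2 * real (Suc k) * defect G N \<mu>"
    using Suc.IH[OF *(2)] hqm_mixed_comm[OF *(1)] by (simp add: algebra_simps)
  finally show ?case .
qed (simp add: mprods_0 hqm_one)

lemma hqm_conj_prods:
  "set xs \<subseteq> N \<Longrightarrow> v \<in> conj_prods xs
    \<Longrightarrow> \<bar>\<mu> v - sum_list (map \<mu> xs)\<bar> \<le> real (length xs) * defect G N \<mu>"
proof (induction xs arbitrary: v)
  case (Cons x xs)
  then obtain g w where *: "g \<in> carrier G" "w \<in> conj_prods xs" "v = conj g x \<otimes> w"
    by (auto elim: conj_prods_ConsE)
  have xw: "x \<in> N" "w \<in> N" "set xs \<subseteq> N" using Cons.prems * conj_prods_N[of xs w] by simp_all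
  have "\<mu> (conj g x) = \<mu> x" using *(1) xw(1) by (rule hqm_conj)
  then have "\<bar>\<mu> v - (\<mu> x + sum_list (map \<mu> xs))\<bar>
      \<le> defect G N \<mu> + \<bar>\<mu> w - sum_list (map \<mu> xs)\<bar>"
    using hqm_defect[OF conj_N[OF *(1) xw(1)] xw(2)] unfolding *(3) by linarith
  also have "\<dots> \<le> real (length (x # xs)) * defect G N \<mu>"
    using Cons.IH[OF xw(3) *(2)] by (simp add: algebra_simps)
  finally show ?case by simp
qed (simp add: hqm_one)

lemma hqm_fills:
  assumes "fills k xs"
  shows "\<bar>sum_list (map \<mu> xs)\<bar> \<le> (2 * real k + real (length xs)) * defect G N \<mu>"
proof -
  obtain v where v: "set xs \<subseteq> N" "v \<in> conj_prods xs" "v \<in> mprods k"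
    using assms by (rule fillsE)
  show ?thesis
    using hqm_mprods[OF v(3)] hqm_conj_prods[OF v(1,2)] by (simp add: distrib_right)
qed

text \<open>For the list of \<open>n\<close>-th powers the left side grows by the factor
  \<open>n\<close>, while the error from the conjugators stays at \<open>length xs\<close> defects
  and vanishes in the limit.\<close>

lemma hqm_le_scl:
  assumes "null xs" shows "\<bar>sum_list (map \<mu> xs)\<bar> \<le> 2 * defect G N \<mu> * scl xs"
proof (rule LIMSEQ_le_const)
  let ?D = "defect G N \<mu>"
  have "(\<lambda>n. 2 * ?D * (real (cl (lpow n xs)) / real n) + ?D * real (length xs) / real n)
      \<longlonglongrightarrow> 2 * ?D * scl xs + 0"
    by (intro tendsto_add tendsto_mult tendsto_const scl_tendsto assms lim_const_over_n)
  then show "(\<lambda>n. 2 * ?D * (real (cl (lpow n xs)) / real n) + ?D * real (length xs) / real n)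
      \<longlonglongrightarrow> 2 * ?D * scl xs" by simp
  have "\<bar>sum_list (map \<mu> xs)\<bar> \<le> 2 * ?D * (real (cl (lpow n xs)) / real n) + ?D * real (length xs) / real n"
    if "n \<ge> 1" for n
  proof -
    have "sum_list (map \<mu> (lpow n ys)) = real n * sum_list (map \<mu> ys)" if "set ys \<subseteq> N" for ys
      using that by (induction ys) (auto simp: hqm_pow algebra_simps)
    then have "\<bar>real n * sum_list (map \<mu> xs)\<bar> \<le> (2 * real (cl (lpow n xs)) + real (length xs)) * ?D"
      using hqm_fills[OF fills_cl[OF null_lpow[OF assms]], of n] null_N[OF assms] by simp
    then have "\<bar>sum_list (map \<mu> xs)\<bar> * real n \<le> (2 * real (cl (lpow n xs)) + real (length xs)) * ?D"
      by (simp add: abs_mult mult.commute)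
    then have "\<bar>sum_list (map \<mu> xs)\<bar> \<le> (2 * real (cl (lpow n xs)) + real (length xs)) * ?D / real n"
      using that by (simp add: pos_le_divide_eq)
    also have "\<dots> = 2 * ?D * (real (cl (lpow n xs)) / real n) + ?D * real (length xs) / real n"
      by (simp only: distrib_left distrib_right add_divide_distrib times_divide_eq_right mult_ac)
    finally show ?thesis .
  qed
  then show "\<exists>N. \<forall>n\<ge>N. \<bar>sum_list (map \<mu> xs)\<bar>
      \<le> 2 * ?D * (real (cl (lpow n xs)) / real n) + ?D * real (length xs) / real n" by blast
qed

lemma sum_list_linv: "set xs \<subseteq> N \<Longrightarrow> sum_list (map \<mu> (linv xs)) = - sum_list (map \<mu> xs)"
  by (induction xs) (auto simp: hqm_inv)

lemma defect_pos_iff: "0 < defect G N \<mu> \<longleftrightarrow> \<mu> \<notin> inv_hom G N"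
proof
  assume pos: "0 < defect G N \<mu>"
  show "\<mu> \<notin> inv_hom G N"
  proof
    assume "\<mu> \<in> inv_hom G N"
    then have "\<mu> (a \<otimes> b) = \<mu> a + \<mu> b" if "a \<in> N" "b \<in> N" for a b
      using that unfolding inv_hom_def by blast
    then have "defect G N \<mu> \<le> 0"
      unfolding defect_def using one_N by (intro cSup_least) (blast, fastforce)
    then show False using pos by simp
  qed
next
  assume "\<mu> \<notin> inv_hom G N"
  then obtain a b where ab: "a \<in> N" "b \<in> N" "\<mu> (a \<otimes> b) \<noteq> \<mu> a + \<mu> b"
    using hqm_conj unfolding inv_hom_def by blast
  then show "0 < defect G N \<mu>" using hqm_defect[OF ab(1,2)] by linarith
qed

end

text \<open>\<open>ev\<close> is abstract and the representing lists are arbitrary, so the equation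
  holds for whatever representation the definition of scl happens to choose.\<close>

lemma duality:
  assumes sub: "set xs \<subseteq> N" "set ys \<subseteq> N" and null: "null (xs @ linv ys)" and m: "0 < m"
    and eval: "\<And>\<mu>. real m * ev \<mu> = sum_list (map \<mu> xs) - sum_list (map \<mu> ys)"
  shows "ereal (scl (xs @ linv ys) / real m) =
    sup0 ((\<lambda>\<mu>. \<bar>ev \<mu>\<bar> / (2 * defect G N \<mu>)) ` (inv_hqm G N - inv_hom G N))"
proof -
  let ?s = "scl (xs @ linv ys)"
  let ?S = "(\<lambda>\<mu>. \<bar>ev \<mu>\<bar> / (2 * defect G N \<mu>)) ` (inv_hqm G N - inv_hom G N)"
  have ev_le: "\<bar>ev \<mu>\<bar> \<le> 2 * defect G N \<mu> * (?s / real m)" if "\<mu> \<in> inv_hqm G N" for \<mu>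
  proof -
    have "real m * \<bar>ev \<mu>\<bar> = \<bar>real m * ev \<mu>\<bar>" by (simp add: abs_mult)
    also have "\<dots> = \<bar>sum_list (map \<mu> (xs @ linv ys))\<bar>"
      unfolding eval using sub sum_list_linv[OF that] by simp
    finally have "real m * \<bar>ev \<mu>\<bar> = \<bar>sum_list (map \<mu> (xs @ linv ys))\<bar>" .
    then have "real m * \<bar>ev \<mu>\<bar> \<le> 2 * defect G N \<mu> * ?s" using hqm_le_scl[OF that null] by simp
    then show ?thesis using m by (simp add: pos_le_divide_eq mult.commute)
  qed
  have upper: "r \<le> ?s / real m" if rS: "r \<in> ?S" for r
  proof -
    obtain \<mu> where \<mu>: "\<mu> \<in> inv_hqm G N" "\<mu> \<notin> inv_hom G N" and r: "r = \<bar>ev \<mu>\<bar> / (2 * defect G N \<mu>)"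
      using rS by blast
    have "0 < defect G N \<mu>" using defect_pos_iff[OF \<mu>(1)] \<mu>(2) by simp
    then show ?thesis using ev_le[OF \<mu>(1)] unfolding r by (simp add: pos_divide_le_eq mult.commute)
  qed
  obtain \<mu> where \<mu>: "\<mu> \<in> inv_hqm G N" "defect G N \<mu> \<le> 1 / 2"
    and ext: "sum_list (map \<mu> xs) - sum_list (map \<mu> ys) = ?s"
    using exists_extremal[OF sub null] .
  have ev: "ev \<mu> = ?s / real m" using eval[of \<mu>] m unfolding ext by (simp add: field_simps)
  have nonneg: "0 \<le> ?s"
  proof -
    have "(\<lambda>n. real (cl (lpow n (xs @ linv ys))) / real n) \<longlonglongrightarrow> ?s" using null by (rule scl_tendsto)
    then show ?thesis by (rule LIMSEQ_le_const) simp
  qed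
  show ?thesis
  proof (cases "\<mu> \<in> inv_hom G N")
    case False
    then have D: "0 < defect G N \<mu>" using defect_pos_iff[OF \<mu>(1)] by simp
    define r where "r = \<bar>ev \<mu>\<bar> / (2 * defect G N \<mu>)"
    \<comment> \<open>As twice the defect is at most 1, the quotient at this functional is at least
      scl; with \<open>upper\<close> it is the maximum.\<close>
    have "?s / real m * (2 * defect G N \<mu>) \<le> ?s / real m * 1"
      using \<mu> nonneg by (intro mult_left_mono) auto
    moreover have "\<bar>ev \<mu>\<bar> = ?s / real m" using nonneg by (simp add: ev)
    moreover have "0 < 2 * defect G N \<mu>" using D by simp
    ultimately have "?s / real m \<le> r" unfolding r_def by (simp only: pos_le_divide_eq mult_1_right)
    moreover have rS: "r \<in> ?S" using \<mu> False unfolding r_def by blast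
    ultimately have r: "r = ?s / real m" using upper[OF rS] by linarith
    have "sup0 ?S = ereal r"
      using rS by (rule sup0_eqI) (unfold r, rule upper)
    then show ?thesis unfolding r by (rule sym)
  next
    case True
    \<comment> \<open>A homomorphism has defect 0, so the lower bound makes its value at the chain
      vanish; that value is scl, which then bounds every quotient by 0.\<close>
    then have "defect G N \<mu> = 0" using defect_pos_iff[OF \<mu>(1)] defect_nonneg[OF \<mu>(1)] by simp
    then have "ev \<mu> = 0" using ev_le[OF \<mu>(1)] by simp
    then have s: "?s / real m = 0" using ev by simp
    have "r = 0" if rS: "r \<in> ?S" for r
    proof -
      obtain \<nu> where \<nu>: "\<nu> \<in> inv_hqm G N" "r = \<bar>ev \<nu>\<bar> / (2 * defect G N \<nu>)"
        using rS by blast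
      have "0 \<le> r" unfolding \<nu>(2) using defect_nonneg[OF \<nu>(1)] by (intro divide_nonneg_nonneg) simp_all
      moreover have "r \<le> 0" using upper[OF rS] unfolding s .
      ultimately show ?thesis by linarith
    qed
    then have zero: "sup0 ?S = ereal 0" by (rule sup0_const)
    show ?thesis by (simp only: s zero)
  qed
qed

end

section \<open>Integral representatives of rational chains\<close>

context mixed_pair
begin

lemma int_chain_rep_iff:
  "int_chain_rep G N d xs ys \<longleftrightarrow> set xs \<subseteq> N \<and> set ys \<subseteq> N \<and>
     d = (\<lambda>z. int (count_list xs z) - int (count_list ys z)) \<and> null (xs @ linv ys)"
proof (cases "set xs \<subseteq> N \<and> set ys \<subseteq> N")
  case True
  then have "set (xs @ linv ys) \<subseteq> N" by simp
  then show ?thesis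
    using fills_gprod_iff[of "xs @ linv ys"] by (simp add: int_chain_rep_def null_def linv_def)
qed (auto simp: int_chain_rep_def)

abbreviation representable :: "('a \<Rightarrow> int) \<Rightarrow> bool" where
  "representable d \<equiv> \<exists>xs ys. int_chain_rep G N d xs ys"

lemma representable_0: "representable (\<lambda>z. 0)"
  by (intro exI[of _ "[]"]) (simp add: int_chain_rep_iff nullI[OF fills_Nil])

lemma representable_add:
  assumes "representable d" "representable e" shows "representable (\<lambda>z. d z + e z)"
proof -
  obtain xs ys xs' ys' where *: "int_chain_rep G N d xs ys" "int_chain_rep G N e xs' ys'"
    using assms by blast
  have "mset ((xs @ linv ys) @ (xs' @ linv ys')) = mset ((xs @ xs') @ linv (ys @ ys'))" by simp
  moreover have "null ((xs @ linv ys) @ (xs' @ linv ys'))"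
    using * unfolding int_chain_rep_iff by (blast intro: null_append)
  ultimately have "null ((xs @ xs') @ linv (ys @ ys'))" using null_perm by blast
  then have "int_chain_rep G N (\<lambda>z. d z + e z) (xs @ xs') (ys @ ys')"
    using * by (simp add: int_chain_rep_iff fun_eq_iff)
  then show ?thesis by blast
qed

lemma representable_minus: assumes "representable d" shows "representable (\<lambda>z. - d z)"
proof -
  obtain xs ys where *: "int_chain_rep G N d xs ys" using assms by blast
  then have "int_chain_rep G N (\<lambda>z. - d z) ys xs" using null_swap by (simp add: int_chain_rep_iff)
  then show ?thesis by blast
qed

lemma representable_scale: assumes "representable d" shows "representable (\<lambda>z. k * d z)"
proof -
  have nat: "representable (\<lambda>z. int n * d z)" for n
  proof (induction n)
    case (Suc n)
    then show ?case using representable_add[OF assms Suc] by (simp add: algebra_simps)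
  qed (simp add: representable_0)
  show ?thesis
  proof (cases k rule: int_cases2)
    case (nonneg n) then show ?thesis using nat by simp
  next
    case (nonpos n) then show ?thesis using representable_minus[OF nat[of n]] by simp
  qed
qed

lemma representable_sum:
  "finite S \<Longrightarrow> (\<And>p. p \<in> S \<Longrightarrow> representable (d p)) \<Longrightarrow> representable (\<lambda>z. \<Sum>p\<in>S. d p z)"
proof (induction rule: finite_induct)
  case (insert p S)
  then have "representable (\<lambda>z. d p z + (\<Sum>p\<in>S. d p z))" by (intro representable_add) simp_all
  then show ?case using insert by simp
qed (simp add: representable_0)

text \<open>Starting from the cancelling pair of \<open>y \<otimes> conj g x\<close>, splitting that
  entry and undoing the conjugation are both free.\<close>

lemma representable_mult:
  assumes x: "x \<in> N" and y: "y \<in> N" and g: "g \<in> carrier G"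
  shows "representable (\<lambda>z. of_bool (z = x) - of_bool (z = y \<otimes> conj g x) + of_bool (z = y))"
proof -
  let ?w = "conj g x"
  have w: "?w \<in> N" using x g by simp
  then have "fills 0 [y \<otimes> ?w, inv (y \<otimes> ?w)]"
    using fills_cancel[OF fills_Nil, of "y \<otimes> ?w"] y by simp
  then have "fills 0 [y, ?w, inv (y \<otimes> ?w)]" using y w by (rule fills_split)
  then have "fills 0 [?w, y, inv (y \<otimes> ?w)]" by (rule fills_perm) simp
  then have "fills 0 [conj (inv g) ?w, y, inv (y \<otimes> ?w)]" by (rule fills_conj[OF _ inv_closed[OF g]])
  moreover have "conj (inv g) ?w = x" using x g by (simp add: m_assoc)
  ultimately have "null [x, y, inv (y \<otimes> ?w)]" using nullI by simp
  then have "int_chain_rep G N (\<lambda>z. of_bool (z = x) - of_bool (z = y \<otimes> ?w) + of_bool (z = y))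
      [x, y] [y \<otimes> ?w]"
    using x y w by (auto simp: int_chain_rep_iff)
  then show ?thesis by blast
qed

section \<open>Pushing boundaries from G into N\<close>

text \<open>A set-theoretic retraction of \<open>G\<close> onto \<open>N\<close> along coset representatives.  It is compatible
  with multiplication by elements of \<open>N\<close>, so pushing a boundary forward along it gives
  a boundary supported in \<open>N\<close>.\<close>

definition coset_rep :: "'a \<Rightarrow> 'a" where
  "coset_rep g = (if g \<in> N then \<one> else SOME h. h \<in> carrier G \<and> inv h \<otimes> g \<in> N)"

definition retract :: "'a \<Rightarrow> 'a" where
  "retract g = inv (coset_rep g) \<otimes> g"

lemma coset_rep:
  assumes "g \<in> carrier G"
  shows "coset_rep g \<in> carrier G" "retract g \<in> N"
proof -
  have "\<exists>h. h \<in> carrier G \<and> inv h \<otimes> g \<in> N" using assms one_N by (intro exI[of _ g]) simp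
  from someI_ex[OF this] show "coset_rep g \<in> carrier G" "retract g \<in> N"
    by (auto simp: coset_rep_def retract_def)
qed

text \<open>This relies on \<open>\<one>\<close> being the representative of the coset
  \<open>N\<close> itself, and it is why a chain supported in \<open>N\<close> survives the
  pushforward unchanged.\<close>

lemma retract_N: "x \<in> N \<Longrightarrow> retract x = x"
  by (simp add: retract_def coset_rep_def)

lemma mult_N_iff:
  assumes "g \<in> carrier G" "x \<in> N" shows "g \<otimes> x \<in> N \<longleftrightarrow> g \<in> N"
proof
  assume "g \<otimes> x \<in> N"
  then have "g \<otimes> x \<otimes> inv x \<in> N" using assms by blast
  then show "g \<in> N" using assms by (simp add: m_assoc)
qed (use assms in blast)

text \<open>The condition under \<open>SOME\<close> depends only on the coset of \<open>g\<close>,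
  so \<open>g\<close> and \<open>g \<otimes> x\<close> are given the same representative.\<close>

lemma retract_mult_right:
  assumes g: "g \<in> carrier G" and x: "x \<in> N" shows "retract (g \<otimes> x) = retract g \<otimes> x"
proof -
  have "inv h \<otimes> (g \<otimes> x) \<in> N \<longleftrightarrow> inv h \<otimes> g \<in> N" if "h \<in> carrier G" for h
    using mult_N_iff[of "inv h \<otimes> g" x] that g x by (simp add: m_assoc)
  then have "(\<lambda>h. h \<in> carrier G \<and> inv h \<otimes> (g \<otimes> x) \<in> N) = (\<lambda>h. h \<in> carrier G \<and> inv h \<otimes> g \<in> N)"
    by blast
  then have "coset_rep (g \<otimes> x) = coset_rep g"
    unfolding coset_rep_def mult_N_iff[OF g x] by simp
  then show ?thesis using coset_rep(1)[OF g] g x by (simp add: retract_def m_assoc)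
qed

lemma retract_mult_left:
  assumes g: "g \<in> carrier G" and x: "x \<in> N" shows "retract (x \<otimes> g) = retract g \<otimes> conj (inv g) x"
proof -
  have "x \<otimes> g = g \<otimes> conj (inv g) x" using g x by (simp add: m_assoc)
  moreover have "conj (inv g) x \<in> N" using g x by (intro conj_N) simp_all
  ultimately show ?thesis using retract_mult_right[OF g] by simp
qed

text \<open>If \<open>h\<close> is in \<open>N\<close>, the retraction commutes with right
  multiplication by it; if \<open>g\<close> is in \<open>N\<close>, moving it to the right
  conjugates it. Both cases have the shape of \<open>representable_mult\<close>.\<close>

lemma representable_boundary:
  assumes "g \<in> carrier G" "h \<in> carrier G" "g \<in> N \<or> h \<in> N"
  shows "representable (\<lambda>z. of_bool (z = retract h) - of_bool (z = retract (g \<otimes> h)) + of_bool (z = retract g))"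
proof (cases "h \<in> N")
  case True
  then have "retract (g \<otimes> h) = retract g \<otimes> conj \<one> h"
    using assms retract_mult_right by simp
  then show ?thesis
    using representable_mult[OF True coset_rep(2)[OF assms(1)] one_closed] True by (simp add: retract_N)
next
  case False
  then have g: "g \<in> N" using assms by simp
  have "retract (g \<otimes> h) = retract h \<otimes> conj (inv h) g" by (rule retract_mult_left[OF assms(2) g])
  then show ?thesis
    using representable_mult[OF g coset_rep(2)[OF assms(2)] inv_closed[OF assms(2)]] g
    by (simp add: retract_N algebra_simps)
qed

lemma in_CA_representable:
  fixes d :: "'a \<Rightarrow> int"
  assumes "in_CA G N d" shows "representable d"
proof -
  obtain S and a :: "'a \<times> 'a \<Rightarrow> int" where fin: "finite S"
    and S: "S \<subseteq> {(g1, g2). g1 \<in> carrier G \<and> g2 \<in> carrier G \<and> (g1 \<in> N \<or> g2 \<in> N)}"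
    and d: "d = (\<lambda>z. \<Sum>p\<in>S. a p * (of_bool (z = snd p) - of_bool (z = fst p \<otimes> snd p) + of_bool (z = fst p)))"
    and supp: "finite {z. d z \<noteq> 0}" "{z. d z \<noteq> 0} \<subseteq> N"
    using assms unfolding in_CA_def in_B1'_def by blast
  \<comment> \<open>A finite set containing the support of \<open>d\<close> and every element
    occurring in the boundaries, so that both sides can be summed against a test function.\<close>
  define W where "W = {z. d z \<noteq> 0} \<union> fst ` S \<union> snd ` S \<union> (\<lambda>p. fst p \<otimes> snd p) ` S"
  have W: "finite W" using fin supp by (simp add: W_def)
  have pair: "(\<Sum>w\<in>W. d w * h w) = (\<Sum>p\<in>S. a p * (h (snd p) - h (fst p \<otimes> snd p) + h (fst p)))"
    for h :: "'a \<Rightarrow> int"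
  proof -
    have pt: "(\<Sum>w\<in>W. of_bool (w = v) * h w) = h v" if "v \<in> W" for v
    proof -
      have "(\<Sum>w\<in>W. of_bool (w = v) * h w) = (\<Sum>w\<in>W. if w = v then h w else 0)"
        by (intro sum.cong) auto
      then show ?thesis using that W by (simp add: sum.delta)
    qed
    have "(\<Sum>w\<in>W. d w * h w) = (\<Sum>w\<in>W. \<Sum>p\<in>S. a p * (of_bool (w = snd p) * h w
        - of_bool (w = fst p \<otimes> snd p) * h w + of_bool (w = fst p) * h w))"
      unfolding d sum_distrib_right by (intro sum.cong refl) (simp add: algebra_simps)
    also have "\<dots> = (\<Sum>p\<in>S. a p * ((\<Sum>w\<in>W. of_bool (w = snd p) * h w)
        - (\<Sum>w\<in>W. of_bool (w = fst p \<otimes> snd p) * h w) + (\<Sum>w\<in>W. of_bool (w = fst p) * h w)))"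
      by (subst sum.swap) (simp only: sum_distrib_left[symmetric] sum_subtractf sum.distrib)
    also have "\<dots> = (\<Sum>p\<in>S. a p * (h (snd p) - h (fst p \<otimes> snd p) + h (fst p)))"
    proof (intro sum.cong refl)
      fix p assume "p \<in> S"
      then have "snd p \<in> W" "fst p \<otimes> snd p \<in> W" "fst p \<in> W" by (auto simp: W_def)
      then show "a p * ((\<Sum>w\<in>W. of_bool (w = snd p) * h w)
          - (\<Sum>w\<in>W. of_bool (w = fst p \<otimes> snd p) * h w) + (\<Sum>w\<in>W. of_bool (w = fst p) * h w))
        = a p * (h (snd p) - h (fst p \<otimes> snd p) + h (fst p))" by (simp only: pt)
    qed
    finally show ?thesis .
  qed
  \<comment> \<open>The pushforward of \<open>d\<close>, evaluated at \<open>z\<close>, is its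
    pairing with the test function \<open>of_bool (z = retract w)\<close>; on the support of
    \<open>d\<close> the retraction is the identity.\<close>
  have "d z = (\<Sum>p\<in>S. a p * (of_bool (z = retract (snd p)) - of_bool (z = retract (fst p \<otimes> snd p))
      + of_bool (z = retract (fst p))))" for z
  proof -
    have "d z = (\<Sum>w\<in>W. if w = z then d w else 0)"
      using W by (cases "d z = 0") (auto simp: W_def sum.delta)
    also have "\<dots> = (\<Sum>w\<in>W. d w * of_bool (z = retract w))"
    proof (intro sum.cong refl)
      fix w
      show "(if w = z then d w else 0) = d w * of_bool (z = retract w)"
      proof (cases "d w = 0")
        case False
        then have "retract w = w" using supp by (intro retract_N) blast
        then show ?thesis by auto
      qed auto
    qed
    finally show ?thesis unfolding pair .
  qed
  then have "d = (\<lambda>z. \<Sum>p\<in>S. a p * (of_bool (z = retract (snd p)) - of_bool (z = retract (fst p \<otimes> snd p))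
      + of_bool (z = retract (fst p))))" by blast
  moreover have "representable \<dots>"
    using S by (intro representable_sum representable_scale representable_boundary fin) auto
  ultimately show ?thesis by simp
qed

section \<open>Agreement of the relational length with the given definitions\<close>

lemma conj_prods_iff_map2:
  "v \<in> conj_prods xs \<longleftrightarrow> (\<exists>gs. length gs = length xs \<and> set gs \<subseteq> carrier G \<and> v = gprod G (map2 conj gs xs))"
proof (induction xs arbitrary: v)
  case (Cons x xs)
  show ?case
  proof
    assume "v \<in> conj_prods (x # xs)"
    then obtain g w where gw: "g \<in> carrier G" "w \<in> conj_prods xs" "v = conj g x \<otimes> w"
      by (rule conj_prods_ConsE)
    then obtain gs where "length gs = length xs" "set gs \<subseteq> carrier G" "w = gprod G (map2 conj gs xs)"
      using Cons.IH by blast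
    then show "\<exists>gs. length gs = length (x # xs) \<and> set gs \<subseteq> carrier G \<and> v = gprod G (map2 conj gs (x # xs))"
      using gw by (intro exI[of _ "g # gs"]) (simp add: gprod_def)
  next
    assume "\<exists>gs. length gs = length (x # xs) \<and> set gs \<subseteq> carrier G \<and> v = gprod G (map2 conj gs (x # xs))"
    then obtain hs where hs: "length hs = length (x # xs)" "set hs \<subseteq> carrier G"
      "v = gprod G (map2 conj hs (x # xs))"
      by blast
    moreover obtain g gs where "hs = g # gs" using hs(1) by (cases hs) auto
    ultimately have gs: "length gs = length xs" "set (g # gs) \<subseteq> carrier G"
      "v = gprod G (map2 conj (g # gs) (x # xs))" by simp_all
    then have "gprod G (map2 conj gs xs) \<in> conj_prods xs" using Cons.IH by auto
    then show "v \<in> conj_prods (x # xs)"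
      using conj_prods_ConsI[of g _ xs x] gs by (simp add: gprod_def)
  qed
qed (simp add: gprod_def)

lemma mcl_eq: "mcl G N v = (LEAST k. v \<in> mprods k)"
  unfolding mcl_def mprods_def by (intro arg_cong[where f = Least]) auto

text \<open>Here the first entry is left unconjugated, whereas \<open>conj_prods\<close> conjugates
  all of them. An overall conjugation removes the difference and preserves products of
  \<open>k\<close> mixed commutators.\<close>

lemma mcl_list_eq:
  assumes null: "null xs" shows "mcl_list G N xs = cl xs"
proof -
  let ?S = "{mcl G N (conj_prod G gs xs) | gs. length gs = length xs - 1 \<and> set gs \<subseteq> carrier G}"
  have sub: "set xs \<subseteq> N" using null by (rule null_N)
  have lower: "cl xs \<le> s" if s: "s \<in> ?S" for s
  proof -
    obtain gs where gs: "length gs = length xs - 1" "set gs \<subseteq> carrier G" "s = mcl G N (conj_prod G gs xs)"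
      using s by blast
    define v where "v = conj_prod G gs xs"
    have v: "v \<in> conj_prods xs"
    proof (cases xs)
      case Nil
      then show ?thesis by (simp add: v_def conj_prod_def gprod_def)
    next
      case (Cons y ys)
      then show ?thesis
        unfolding v_def conj_prod_def conj_prods_iff_map2 using gs by (intro exI[of _ "\<one> # gs"]) simp
    qed
    obtain u where u: "u \<in> mprods (length xs)" "v = u \<otimes> gprod G xs"
      using conj_prods_gprod[OF sub v] by blast
    obtain k where "gprod G xs \<in> mprods k"
      using null fills_gprod_iff[OF sub] unfolding null_def mixed_comm_subgroup_iff by blast
    \<comment> \<open>Some such length exists, so the \<open>LEAST\<close> defining \<open>s\<close>
      is attained.\<close>
    then have "v \<in> mprods (length xs + k)" unfolding u(2) by (rule mprods_mult[OF u(1)])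
    then have "v \<in> mprods s" unfolding gs(3) v_def[symmetric] mcl_eq by (rule LeastI)
    then show ?thesis using v sub by (intro cl_le fillsI)
  qed
  moreover have "\<exists>s\<in>?S. s \<le> cl xs"
  proof -
    obtain v where v: "v \<in> conj_prods xs" "v \<in> mprods (cl xs)"
      using fills_cl[OF null] by (rule fillsE)
    have "\<exists>gs. length gs = length xs - 1 \<and> set gs \<subseteq> carrier G \<and> conj_prod G gs xs \<in> mprods (cl xs)"
    proof (cases xs)
      case Nil
      then show ?thesis using v by (simp add: conj_prod_def gprod_def)
    next
      case (Cons y ys)
      then obtain g w where gw: "g \<in> carrier G" "w \<in> conj_prods ys" "v = conj g y \<otimes> w"
        using v by (auto elim: conj_prods_ConsE)
      have N: "y \<in> carrier G" "set ys \<subseteq> N" "w \<in> carrier G"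
        using sub gw(2) conj_prods_carrier[of ys w] unfolding Cons by auto
      \<comment> \<open>Conjugating the whole product by \<open>inv g\<close> frees the first entry
        from its conjugator and modifies only the later ones.\<close>
      have "conj (inv g) w \<in> conj_prods ys" using gw N by (intro conj_prods_conj) simp_all
      then obtain gs where gs: "length gs = length ys" "set gs \<subseteq> carrier G"
        "conj (inv g) w = gprod G (map2 conj gs ys)"
        unfolding conj_prods_iff_map2 by blast
      have "conj_prod G gs xs = y \<otimes> conj (inv g) w"
        using N unfolding gs(3) by (simp add: conj_prod_def Cons gprod_def)
      also have "\<dots> = conj (inv g) v" using gw N by (simp add: m_assoc)
      also have "\<dots> \<in> mprods (cl xs)" using gw v by (intro mprods_conj) simp_all
      finally show ?thesis using gs Cons by auto
    qed
    then obtain gs where gs: "length gs = length xs - 1" "set gs \<subseteq> carrier G"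
      "conj_prod G gs xs \<in> mprods (cl xs)" by blast
    then have "mcl G N (conj_prod G gs xs) \<le> cl xs" unfolding mcl_eq by (intro Least_le)
    then show ?thesis using gs by blast
  qed
  then obtain s where s: "s \<in> ?S" "s \<le> cl xs" by blast
  ultimately have "s = cl xs" "\<And>s'. s' \<in> ?S \<Longrightarrow> s \<le> s'" by (meson order_antisym order_trans)+
  then have "Inf ?S = cl xs" using s(1) by (intro cInf_eq_minimum) auto
  then show ?thesis by (simp add: mcl_list_def)
qed

lemma mscl_list_eq: "null xs \<Longrightarrow> mscl_list G N xs = scl xs"
  unfolding mscl_list_def scl_def by (simp add: mcl_list_eq null_lpow flip: lpow_def)

end

section \<open>Clearing denominators and evaluating chains\<close>

lemma common_denominator:
  fixes a :: "'b \<Rightarrow> rat"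
  assumes "finite S"
  obtains m :: nat where "m > 0" "\<And>p. p \<in> S \<Longrightarrow> of_nat m * a p \<in> \<int>"
proof -
  have "\<exists>m::nat. m > 0 \<and> (\<forall>p\<in>S. of_nat m * a p \<in> \<int>)"
    using assms
  proof (induction rule: finite_induct)
    case empty
    show ?case by (rule exI[of _ 1]) simp
  next
    case (insert p S)
    then obtain m :: nat where m: "m > 0" "\<forall>p\<in>S. of_nat m * a p \<in> \<int>" by blast
    obtain i j where ij: "quotient_of (a p) = (i, j)" by fastforce
    then have j: "j > 0" "a p = of_int i / of_int j"
      by (rule quotient_of_denom_pos, rule quotient_of_div)
    have "of_nat (nat j * m) * a q \<in> \<int>" if "q \<in> insert p S" for q
    proof (cases "q = p")
      case True
      have "of_nat (nat j * m) * a p = of_int (int m * i)" using j by simp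
      then show ?thesis using True by (metis Ints_of_int)
    next
      case False
      then have "of_nat m * a q \<in> \<int>" using m that by blast
      then have "of_nat (nat j) * (of_nat m * a q) \<in> \<int>" by (rule Ints_mult[OF Ints_of_nat])
      then show ?thesis by (simp only: of_nat_mult mult.assoc)
    qed
    then show ?case using m j by (intro exI[of _ "nat j * m"]) auto
  qed
  then show ?thesis using that by blast
qed

text \<open>The multiplier clears the coefficients of a 2-chain bounding \<open>c\<close>, not
  merely those of \<open>c\<close>: the multiple must be an integral boundary, which integral
  coefficients alone would not show.\<close>

lemma in_CA_clear_denominators:
  fixes c :: "'a \<Rightarrow> rat"
  assumes "in_CA G N c"
  shows "\<exists>m::nat. m > 0 \<and> (\<forall>z. of_nat m * c z \<in> \<int>) \<and> in_CA G N (\<lambda>z. \<lfloor>of_nat m * c z\<rfloor>)"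
proof -
  obtain S and a :: "'a \<times> 'a \<Rightarrow> rat" where fin: "finite S"
    and S: "S \<subseteq> {(g1, g2). g1 \<in> carrier G \<and> g2 \<in> carrier G \<and> (g1 \<in> N \<or> g2 \<in> N)}"
    and c: "c = (\<lambda>z. \<Sum>p\<in>S. a p * (of_bool (z = snd p) - of_bool (z = fst p \<otimes>\<^bsub>G\<^esub> snd p)
                                 + of_bool (z = fst p)))"
    and supp: "finite {z. c z \<noteq> 0}" "{z. c z \<noteq> 0} \<subseteq> N"
    using assms unfolding in_CA_def in_B1'_def by blast
  obtain m :: nat where m: "m > 0" "\<And>p. p \<in> S \<Longrightarrow> of_nat m * a p \<in> \<int>"
    using common_denominator[OF fin] by metis
  define b where "b p = \<lfloor>of_nat m * a p\<rfloor>" for p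
  have b: "of_int (b p) = of_nat m * a p" if "p \<in> S" for p
    using m(2)[OF that] by (simp add: b_def)
  define d where "d z = (\<Sum>p\<in>S. b p * (of_bool (z = snd p) - of_bool (z = fst p \<otimes>\<^bsub>G\<^esub> snd p)
                                 + of_bool (z = fst p)))" for z
  have d: "of_nat m * c z = of_int (d z)" for z
    unfolding c d_def sum_distrib_left of_int_sum
    by (intro sum.cong refl) (simp add: b mult.assoc)
  have "in_B1' G N d" unfolding in_B1'_def
    by (intro exI[of _ S] exI[of _ b] conjI fin S) (simp add: d_def fun_eq_iff)
  moreover have "{z. d z \<noteq> 0} \<subseteq> {z. c z \<noteq> 0}"
    using d by (metis (mono_tags, lifting) Collect_mono mult_zero_right of_int_eq_0_iff)
  ultimately have "in_CA G N d"
    using supp unfolding in_CA_def by (meson finite_subset subset_trans)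
  then show ?thesis using m(1) by (intro exI[of _ m]) (simp add: d)
qed

lemma sum_list_eq_sum_count:
  fixes f :: "'a \<Rightarrow> real"
  assumes "finite W" "set xs \<subseteq> W"
  shows "sum_list (map f xs) = (\<Sum>z\<in>W. real (count_list xs z) * f z)"
  using assms(2)
proof (induction xs)
  case (Cons x xs)
  have "(\<Sum>z\<in>W. real (count_list (x # xs) z) * f z)
      = (\<Sum>z\<in>W. real (count_list xs z) * f z + (if z = x then f z else 0))"
    by (intro sum.cong) (auto simp: algebra_simps)
  then show ?case using Cons assms(1) by (simp add: sum.distrib sum.delta)
qed simp

theorem theorem5p22:
  fixes G :: "('a, 'b) monoid_scheme" and N :: "'a set" and c :: "'a \<Rightarrow> rat"
  assumes "group G" and "N \<lhd> G" and "in_CA G N c"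
  shows "ereal (mscl_Q G N c) =
           sup0 ((\<lambda>\<mu>. \<bar>chain_eval \<mu> c\<bar> / (2 * defect G N \<mu>)) ` (inv_hqm G N - inv_hom G N))"
proof -
  interpret mixed_pair N G using assms(2) by (simp add: mixed_pair_def)
  define m where "m = (SOME m :: nat. m > 0 \<and> (\<forall>z. of_nat m * c z \<in> \<int>) \<and>
    in_CA G N (\<lambda>z. \<lfloor>of_nat m * c z\<rfloor>))"
  have "m > 0 \<and> (\<forall>z. of_nat m * c z \<in> \<int>) \<and> in_CA G N (\<lambda>z. \<lfloor>of_nat m * c z\<rfloor>)"
    unfolding m_def by (rule someI_ex[OF in_CA_clear_denominators[OF assms(3)]])
  then have m: "m > 0" "\<And>z. of_nat m * c z \<in> \<int>" "in_CA G N (\<lambda>z. \<lfloor>of_nat m * c z\<rfloor>)" by auto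
  define d where "d z = \<lfloor>of_nat m * c z\<rfloor>" for z
  have d: "of_int (d z) = of_nat m * c z" for z using m(2)[of z] by (simp add: d_def)
  define p where "p = (SOME (xs, ys). int_chain_rep G N d xs ys)"
  obtain xs ys where p: "p = (xs, ys)" by fastforce
  have "\<exists>p. case p of (xs, ys) \<Rightarrow> int_chain_rep G N d xs ys"
    using in_CA_representable[OF m(3)] by (auto simp: d_def[abs_def])
  from someI_ex[OF this] have repeat: "int_chain_rep G N d xs ys"
    unfolding p_def[symmetric] p by simp
  then have sub: "set xs \<subseteq> N" "set ys \<subseteq> N" and null: "null (xs @ linv ys)"
    and dz: "\<And>z. d z = int (count_list xs z) - int (count_list ys z)"
    by (simp_all add: int_chain_rep_iff)
  have "mscl_Z G N d = scl (xs @ linv ys)"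
    unfolding mscl_Z_def p_def[symmetric] p using mscl_list_eq[OF null] by (simp add: linv_def)
  then have Q: "mscl_Q G N c = scl (xs @ linv ys) / real m"
    unfolding mscl_Q_def m_def[symmetric] by (simp add: d_def[abs_def])
  have eval: "real m * chain_eval \<mu> c = sum_list (map \<mu> xs) - sum_list (map \<mu> ys)" for \<mu>
  proof -
    let ?W = "set xs \<union> set ys"
    have mc: "real m * real_of_rat (c z) = real (count_list xs z) - real (count_list ys z)" for z
    proof -
      have "real_of_rat (of_nat m * c z) = real_of_rat (of_int (d z))" unfolding d ..
      then show ?thesis by (simp add: of_rat_mult of_rat_diff dz)
    qed
    \<comment> \<open>Elements may occur in both lists and cancel, so \<open>?W\<close> can exceed
      the support of \<open>c\<close>; the additional terms of the sum are zero.\<close>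
    have "c z = 0" if "z \<notin> ?W" for z
      using mc[of z] that m(1) by (simp add: count_list_0_iff)
    then have "{z. c z \<noteq> 0} \<subseteq> ?W" by blast
    then have "chain_eval \<mu> c = (\<Sum>z\<in>?W. real_of_rat (c z) * \<mu> z)"
      unfolding chain_eval_def by (intro sum.mono_neutral_left) auto
    then have "real m * chain_eval \<mu> c = (\<Sum>z\<in>?W. (real m * real_of_rat (c z)) * \<mu> z)"
      by (simp add: sum_distrib_left mult.assoc)
    also have "\<dots> = (\<Sum>z\<in>?W. real (count_list xs z) * \<mu> z) - (\<Sum>z\<in>?W. real (count_list ys z) * \<mu> z)"
      unfolding mc by (simp add: left_diff_distrib sum_subtractf)
    also have "\<dots> = sum_list (map \<mu> xs) - sum_list (map \<mu> ys)"
      using sum_list_eq_sum_count[of ?W] by simp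
    finally show ?thesis .
  qed
  show ?thesis unfolding Q by (rule duality[OF sub null m(1) eval])
qed

end
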